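(* For each $n\geq 4$, there exists a $2n$-dimensional nilmanifold endowed with a non-nilpotent (invariant) complex structure that admits pseudo-Kähler metrics.
   Context: A nilmanifold is a compact quotient $\Gamma\backslash G$ of a connected, simply connected nilpotent Lie group $G$ by a lattice $\Gamma$ of maximal rank; dimension here is real dimension. An invariant complex structure on it is one induced by a left-invariant complex structure on $G$, i.e. by a complex structure $J$ on the Lie algebra $\mathfrak g$ of $G$. The ascending $J$-compatible series of $\mathfrak g$ is defined by $\mathfrak a_0(J)=\{0\}$ and $\mathfrak a_k(J)=\{X\in\mathfrak g\mid [X,\mathfrak g]\subseteq\mathfrak a_{k-1}(J)\text{ and }[JX,\mathfrak g]\subseteq\mathfrak a_{k-1}(J)\}$ for $k\geq1$. The complex structure $J$ is nilpotent if $\mathfrak a_t(J)=\mathfrak g$ for some integer $t>0$, and non-nilpotent if $\mathfrak a_t(J)\neq\mathfrak g$ for every $t\geq0$. A pseudo-Kähler metric on a complex manifold $(M,J)$ is given by a smooth real closed non-degenerate $2$-form $F$ with $F(JU,JV)=F(U,V)$ for all vector fields $U,V$ (i.e. of bidegree $(1,1)$). *)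

theory Defs
  imports "HOL-Analysis.Analysis" "HOL-Algebra.Generated_Groups"
begin

section \<open>Smooth manifolds\<close>

text \<open>For open \<open>S\<close> in a Euclidean space, \<open>Ck_on k S f\<close> says that all iterated directional derivatives
  of \<open>f\<close> up to order \<open>k\<close> exist and are continuous on \<open>S\<close>.\<close>

fun Ck_on :: "nat \<Rightarrow> 'a::euclidean_space set \<Rightarrow> ('a \<Rightarrow> 'b::real_normed_vector) \<Rightarrow> bool" where
  "Ck_on 0 S f \<longleftrightarrow> continuous_on S f"
| "Ck_on (Suc k) S f \<longleftrightarrow>
     (\<forall>x\<in>S. f differentiable (at x)) \<and>
     (\<forall>v. Ck_on k S (\<lambda>x. frechet_derivative f (at x) v))"

definition smooth_on :: "'a::euclidean_space set \<Rightarrow> ('a \<Rightarrow> 'b::real_normed_vector) \<Rightarrow> bool" where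
  "smooth_on S f \<longleftrightarrow> (\<forall>k. Ck_on k S f)"

text \<open>A chart is a pair of a domain and a coordinate map; the values of the coordinate map outside
  the domain are irrelevant. The dimension of a manifold is the dimension of the model space \<open>'e\<close>.
  The atlas is not required to be maximal.\<close>

type_synonym ('p, 'e) chart = "'p set \<times> ('p \<Rightarrow> 'e)"

record ('p, 'e) mfd =
  mtop :: "'p topology"
  atlas :: "('p, 'e) chart set"

definition chart_ran :: "('p, 'e) chart \<Rightarrow> 'e set" where
  "chart_ran c = snd c ` fst c"

definition chart_inv :: "('p, 'e) chart \<Rightarrow> 'e \<Rightarrow> 'p" where
  "chart_inv c = inv_into (fst c) (snd c)"

text \<open>Coordinate representation of a map \<open>f\<close> with respect to charts \<open>c\<close> (source) and \<open>d\<close> (target),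
  with its domain of definition. For \<open>f = (\<lambda>p. p)\<close> this is the transition map from \<open>c\<close> to \<open>d\<close>.\<close>

definition rep :: "('p \<Rightarrow> 'q) \<Rightarrow> ('p, 'e) chart \<Rightarrow> ('q, 'f) chart \<Rightarrow> 'e \<Rightarrow> 'f" where
  "rep f c d = (\<lambda>x. snd d (f (chart_inv c x)))"

definition rep_dom :: "('p \<Rightarrow> 'q) \<Rightarrow> ('p, 'e) chart \<Rightarrow> ('q, 'f) chart \<Rightarrow> 'e set" where
  "rep_dom f c d = {x \<in> chart_ran c. f (chart_inv c x) \<in> fst d}"

definition smooth_manifold :: "('p, 'e::euclidean_space) mfd \<Rightarrow> bool" where
  "smooth_manifold M \<longleftrightarrow>
     Hausdorff_space (mtop M) \<and> second_countable (mtop M) \<and>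
     (\<Union>c\<in>atlas M. fst c) = topspace (mtop M) \<and>
     (\<forall>c\<in>atlas M. openin (mtop M) (fst c) \<and> open (chart_ran c) \<and>
        homeomorphic_map (subtopology (mtop M) (fst c)) (top_of_set (chart_ran c)) (snd c)) \<and>
     (\<forall>c\<in>atlas M. \<forall>d\<in>atlas M. smooth_on (rep_dom (\<lambda>p. p) c d) (rep (\<lambda>p. p) c d))"

definition smooth_map ::
  "('p, 'e::euclidean_space) mfd \<Rightarrow> ('q, 'f::euclidean_space) mfd \<Rightarrow> ('p \<Rightarrow> 'q) \<Rightarrow> bool" where
  "smooth_map M N f \<longleftrightarrow>
     continuous_map (mtop M) (mtop N) f \<and>
     (\<forall>c\<in>atlas M. \<forall>d\<in>atlas N. smooth_on (rep_dom f c d) (rep f c d))"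

definition prod_mfd :: "('p, 'e) mfd \<Rightarrow> ('q, 'f) mfd \<Rightarrow> ('p \<times> 'q, 'e \<times> 'f) mfd" where
  "prod_mfd M N =
     \<lparr> mtop = prod_topology (mtop M) (mtop N),
       atlas = {(fst c \<times> fst d, map_prod (snd c) (snd d)) | c d. c \<in> atlas M \<and> d \<in> atlas N} \<rparr>"


section \<open>Tensor fields\<close>

text \<open>Tensor fields are given by their components in each chart of the atlas, subject to the usual
  transformation rule under change of charts: for a chart \<open>c\<close> and a point \<open>x\<close> of its range,
  a vector field has the value \<open>X c x\<close>, an endomorphism field of the tangent bundle the value \<open>J c x\<close>
  and a 2-form the value \<open>F c x\<close>. The following three predicates relate such fields along a map;
  along the identity they are the transformation rules.\<close>

type_synonym ('p, 'e) vfield = "('p, 'e) chart \<Rightarrow> 'e \<Rightarrow> 'e"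
type_synonym ('p, 'e) efield = "('p, 'e) chart \<Rightarrow> 'e \<Rightarrow> 'e \<Rightarrow> 'e"
type_synonym ('p, 'e) form2 = "('p, 'e) chart \<Rightarrow> 'e \<Rightarrow> 'e \<Rightarrow> 'e \<Rightarrow> real"

definition related_vf ::
  "('p, 'e::euclidean_space) mfd \<Rightarrow> ('q, 'f::euclidean_space) mfd \<Rightarrow> ('p \<Rightarrow> 'q) \<Rightarrow>
   ('p, 'e) vfield \<Rightarrow> ('q, 'f) vfield \<Rightarrow> bool" where
  "related_vf M N f X Y \<longleftrightarrow>
     (\<forall>c\<in>atlas M. \<forall>d\<in>atlas N. \<forall>x\<in>rep_dom f c d.
        frechet_derivative (rep f c d) (at x) (X c x) = Y d (rep f c d x))"

definition related_endo ::
  "('p, 'e::euclidean_space) mfd \<Rightarrow> ('q, 'f::euclidean_space) mfd \<Rightarrow> ('p \<Rightarrow> 'q) \<Rightarrow>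
   ('p, 'e) efield \<Rightarrow> ('q, 'f) efield \<Rightarrow> bool" where
  "related_endo M N f J J' \<longleftrightarrow>
     (\<forall>c\<in>atlas M. \<forall>d\<in>atlas N. \<forall>x\<in>rep_dom f c d. \<forall>v.
        frechet_derivative (rep f c d) (at x) (J c x v) =
        J' d (rep f c d x) (frechet_derivative (rep f c d) (at x) v))"

definition related_form2 ::
  "('p, 'e::euclidean_space) mfd \<Rightarrow> ('q, 'f::euclidean_space) mfd \<Rightarrow> ('p \<Rightarrow> 'q) \<Rightarrow>
   ('p, 'e) form2 \<Rightarrow> ('q, 'f) form2 \<Rightarrow> bool" where
  "related_form2 M N f F F' \<longleftrightarrow>
     (\<forall>c\<in>atlas M. \<forall>d\<in>atlas N. \<forall>x\<in>rep_dom f c d. \<forall>u v.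
        F c x u v = F' d (rep f c d x) (frechet_derivative (rep f c d) (at x) u)
                                       (frechet_derivative (rep f c d) (at x) v))"

text \<open>Vector fields are extended by zero, so that equality of vector fields is equality in HOL.\<close>

definition vector_field :: "('p, 'e::euclidean_space) mfd \<Rightarrow> ('p, 'e) vfield \<Rightarrow> bool" where
  "vector_field M X \<longleftrightarrow>
     (\<forall>c x. \<not> (c \<in> atlas M \<and> x \<in> chart_ran c) \<longrightarrow> X c x = 0) \<and>
     (\<forall>c\<in>atlas M. smooth_on (chart_ran c) (X c)) \<and>
     related_vf M M (\<lambda>p. p) X X"

definition lie_bracket ::
  "('p, 'e::euclidean_space) mfd \<Rightarrow> ('p, 'e) vfield \<Rightarrow> ('p, 'e) vfield \<Rightarrow> ('p, 'e) vfield" where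
  "lie_bracket M X Y = (\<lambda>c x.
     if c \<in> atlas M \<and> x \<in> chart_ran c
     then frechet_derivative (Y c) (at x) (X c x) - frechet_derivative (X c) (at x) (Y c x)
     else 0)"

definition endo_app ::
  "('p, 'e::euclidean_space) mfd \<Rightarrow> ('p, 'e) efield \<Rightarrow> ('p, 'e) vfield \<Rightarrow> ('p, 'e) vfield" where
  "endo_app M J X = (\<lambda>c x. if c \<in> atlas M \<and> x \<in> chart_ran c then J c x (X c x) else 0)"

definition almost_complex_structure ::
  "('p, 'e::euclidean_space) mfd \<Rightarrow> ('p, 'e) efield \<Rightarrow> bool" where
  "almost_complex_structure M J \<longleftrightarrow>
     (\<forall>c\<in>atlas M. \<forall>x\<in>chart_ran c. linear (J c x) \<and> (\<forall>v. J c x (J c x v) = - v)) \<and>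
     (\<forall>c\<in>atlas M. \<forall>v. smooth_on (chart_ran c) (\<lambda>x. J c x v)) \<and>
     related_endo M M (\<lambda>p. p) J J"

text \<open>Integrability is expressed by the vanishing of the Nijenhuis tensor.\<close>

definition complex_manifold ::
  "('p, 'e::euclidean_space) mfd \<Rightarrow> ('p, 'e) efield \<Rightarrow> bool" where
  "complex_manifold M J \<longleftrightarrow>
     smooth_manifold M \<and> almost_complex_structure M J \<and>
     (\<forall>X Y. vector_field M X \<longrightarrow> vector_field M Y \<longrightarrow>
        (\<forall>c\<in>atlas M. \<forall>x\<in>chart_ran c.
           lie_bracket M (endo_app M J X) (endo_app M J Y) c x
           - J c x (lie_bracket M (endo_app M J X) Y c x)
           - J c x (lie_bracket M X (endo_app M J Y) c x)
           - lie_bracket M X Y c x = 0))"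

definition two_form :: "('p, 'e::euclidean_space) mfd \<Rightarrow> ('p, 'e) form2 \<Rightarrow> bool" where
  "two_form M F \<longleftrightarrow>
     (\<forall>c\<in>atlas M. \<forall>x\<in>chart_ran c. bilinear (F c x) \<and> (\<forall>u v. F c x u v = - F c x v u)) \<and>
     (\<forall>c\<in>atlas M. \<forall>u v. smooth_on (chart_ran c) (\<lambda>x. F c x u v)) \<and>
     related_form2 M M (\<lambda>p. p) F F"

text \<open>\<open>dF(u,v,w)\<close> is evaluated on constant vector fields of a chart, so no bracket terms occur.\<close>

definition closed_form2 :: "('p, 'e::euclidean_space) mfd \<Rightarrow> ('p, 'e) form2 \<Rightarrow> bool" where
  "closed_form2 M F \<longleftrightarrow>
     (\<forall>c\<in>atlas M. \<forall>x\<in>chart_ran c. \<forall>u v w.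
        frechet_derivative (\<lambda>y. F c y v w) (at x) u
        - frechet_derivative (\<lambda>y. F c y u w) (at x) v
        + frechet_derivative (\<lambda>y. F c y u v) (at x) w = 0)"

definition nondegenerate_form2 :: "('p, 'e::euclidean_space) mfd \<Rightarrow> ('p, 'e) form2 \<Rightarrow> bool" where
  "nondegenerate_form2 M F \<longleftrightarrow>
     (\<forall>c\<in>atlas M. \<forall>x\<in>chart_ran c. \<forall>u. (\<forall>v. F c x u v = 0) \<longrightarrow> u = 0)"

definition pseudo_kaehler_metric ::
  "('p, 'e::euclidean_space) mfd \<Rightarrow> ('p, 'e) efield \<Rightarrow> ('p, 'e) form2 \<Rightarrow> bool" where
  "pseudo_kaehler_metric M J F \<longleftrightarrow>
     two_form M F \<and> closed_form2 M F \<and> nondegenerate_form2 M F \<and>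
     (\<forall>c\<in>atlas M. \<forall>x\<in>chart_ran c. \<forall>u v. F c x (J c x u) (J c x v) = F c x u v)"


section \<open>Lie groups and nilmanifolds\<close>

definition lie_group :: "'p monoid \<Rightarrow> ('p, 'e::euclidean_space) mfd \<Rightarrow> bool" where
  "lie_group G M \<longleftrightarrow>
     group G \<and> smooth_manifold M \<and> carrier G = topspace (mtop M) \<and>
     smooth_map (prod_mfd M M) M (\<lambda>(g, h). g \<otimes>\<^bsub>G\<^esub> h) \<and>
     smooth_map M M (\<lambda>g. inv\<^bsub>G\<^esub> g)"

fun lower_central :: "'p monoid \<Rightarrow> nat \<Rightarrow> 'p set" where
  "lower_central G 0 = carrier G"
| "lower_central G (Suc k) =
     generate G {g \<otimes>\<^bsub>G\<^esub> h \<otimes>\<^bsub>G\<^esub> inv\<^bsub>G\<^esub> g \<otimes>\<^bsub>G\<^esub> inv\<^bsub>G\<^esub> h | g h.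
                   g \<in> lower_central G k \<and> h \<in> carrier G}"

definition nilpotent_group :: "'p monoid \<Rightarrow> bool" where
  "nilpotent_group G \<longleftrightarrow> (\<exists>k. lower_central G k = {\<one>\<^bsub>G\<^esub>})"

text \<open>The library notion \<open>simply_connected\<close>, for abstract topologies: any two loops are freely
  homotopic (applied to constant loops, this includes path-connectedness).\<close>

definition simply_connected_space :: "'p topology \<Rightarrow> bool" where
  "simply_connected_space X \<longleftrightarrow>
     (\<forall>p q. pathin X p \<and> p 1 = p 0 \<and> pathin X q \<and> q 1 = q 0 \<longrightarrow>
        homotopic_with (\<lambda>r. r 1 = r 0) (top_of_set {0..1::real}) X p q)"

text \<open>The quotient by the left action of \<open>\<Gamma>\<close>: its points are the cosets \<open>\<Gamma>g\<close>, it carries the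
  quotient topology, and its charts are the charts of \<open>M\<close> restricted to open sets \<open>W\<close> on which
  the projection is injective.\<close>

definition quotient_mfd :: "'p monoid \<Rightarrow> ('p, 'e) mfd \<Rightarrow> 'p set \<Rightarrow> ('p set, 'e) mfd" where
  "quotient_mfd G M \<Gamma> =
     \<lparr> mtop = topology (\<lambda>U. U \<subseteq> rcosets\<^bsub>G\<^esub> \<Gamma> \<and> openin (mtop M) {g \<in> topspace (mtop M). \<Gamma> #>\<^bsub>G\<^esub> g \<in> U}),
       atlas = {((\<lambda>g. \<Gamma> #>\<^bsub>G\<^esub> g) ` W, \<lambda>q. \<phi> (inv_into W (\<lambda>g. \<Gamma> #>\<^bsub>G\<^esub> g) q)) | W U \<phi>.
                 (U, \<phi>) \<in> atlas M \<and> W \<subseteq> U \<and> openin (mtop M) W \<and> inj_on (\<lambda>g. \<Gamma> #>\<^bsub>G\<^esub> g) W} \<rparr>"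

lemma openin_quotient_mfd:
  "openin (mtop (quotient_mfd G M \<Gamma>)) U \<longleftrightarrow>
     U \<subseteq> rcosets\<^bsub>G\<^esub> \<Gamma> \<and> openin (mtop M) {g \<in> topspace (mtop M). \<Gamma> #>\<^bsub>G\<^esub> g \<in> U}"
proof -
  let ?p = "\<lambda>U. {g \<in> topspace (mtop M). \<Gamma> #>\<^bsub>G\<^esub> g \<in> U}"
  have "?p (S \<inter> T) = ?p S \<inter> ?p T" for S T by auto
  moreover have "?p (\<Union>\<K>) = \<Union>(?p ` \<K>)" for \<K> by auto
  ultimately have "istopology (\<lambda>U. U \<subseteq> rcosets\<^bsub>G\<^esub> \<Gamma> \<and> openin (mtop M) (?p U))"
    unfolding istopology_def
    by (smt (verit) Sup_least image_iff le_infI1 openin_Int openin_Union)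
  then show ?thesis
    by (simp add: quotient_mfd_def topology_inverse')
qed

text \<open>A lattice of maximal rank in a connected, simply connected nilpotent Lie group is a discrete
  subgroup with compact quotient.\<close>

definition nilmanifold :: "'p monoid \<Rightarrow> ('p, 'e::euclidean_space) mfd \<Rightarrow> 'p set \<Rightarrow> bool" where
  "nilmanifold G M \<Gamma> \<longleftrightarrow>
     lie_group G M \<and> nilpotent_group G \<and>
     connected_space (mtop M) \<and> simply_connected_space (mtop M) \<and>
     subgroup \<Gamma> G \<and> subtopology (mtop M) \<Gamma> = discrete_topology \<Gamma> \<and>
     compact_space (mtop (quotient_mfd G M \<Gamma>))"


section \<open>Invariant complex structures\<close>

text \<open>The Lie algebra is the space of left-invariant vector fields. A complex structure on it is the
  same as a left-invariant complex structure on the group, and it acts by \<open>endo_app M J\<close>.\<close>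

definition lie_algebra :: "'p monoid \<Rightarrow> ('p, 'e::euclidean_space) mfd \<Rightarrow> ('p, 'e) vfield set" where
  "lie_algebra G M =
     {X. vector_field M X \<and> (\<forall>g\<in>carrier G. related_vf M M (\<lambda>h. g \<otimes>\<^bsub>G\<^esub> h) X X)}"

definition left_invariant_complex_structure ::
  "'p monoid \<Rightarrow> ('p, 'e::euclidean_space) mfd \<Rightarrow> ('p, 'e) efield \<Rightarrow> bool" where
  "left_invariant_complex_structure G M J \<longleftrightarrow>
     complex_manifold M J \<and> (\<forall>g\<in>carrier G. related_endo M M (\<lambda>h. g \<otimes>\<^bsub>G\<^esub> h) J J)"

fun asc_series ::
  "'p monoid \<Rightarrow> ('p, 'e::euclidean_space) mfd \<Rightarrow> ('p, 'e) efield \<Rightarrow> nat \<Rightarrow> ('p, 'e) vfield set" where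
  "asc_series G M J 0 = {\<lambda>c x. 0}"
| "asc_series G M J (Suc k) =
     {X \<in> lie_algebra G M.
        (\<forall>Y\<in>lie_algebra G M. lie_bracket M X Y \<in> asc_series G M J k) \<and>
        (\<forall>Y\<in>lie_algebra G M. lie_bracket M (endo_app M J X) Y \<in> asc_series G M J k)}"

definition non_nilpotent_structure ::
  "'p monoid \<Rightarrow> ('p, 'e::euclidean_space) mfd \<Rightarrow> ('p, 'e) efield \<Rightarrow> bool" where
  "non_nilpotent_structure G M J \<longleftrightarrow> (\<forall>t. asc_series G M J t \<noteq> lie_algebra G M)"

text \<open>\<open>J'\<close> is the complex structure on the quotient induced by the left-invariant \<open>J\<close> on the group.\<close>

definition induced_complex_structure ::
  "'p monoid \<Rightarrow> ('p, 'e::euclidean_space) mfd \<Rightarrow> 'p set \<Rightarrow> ('p, 'e) efield \<Rightarrow> ('p set, 'e) efield \<Rightarrow> bool" where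
  "induced_complex_structure G M \<Gamma> J J' \<longleftrightarrow>
     complex_manifold (quotient_mfd G M \<Gamma>) J' \<and>
     related_endo M (quotient_mfd G M \<Gamma>) (\<lambda>g. \<Gamma> #>\<^bsub>G\<^esub> g) J J'"

end

theory Submission
  imports Defs
begin

text \<open>The manifold is a quotient of \<open>\<complex>\<^sup>n\<close> by a group that acts simply transitively through
  \<^emph>\<open>complex affine\<close> maps \<open>y \<mapsto> x + A x y\<close>. Transporting the group to \<open>\<complex>\<^sup>n\<close> along the orbit of \<open>0\<close>,
  left translations become these affine maps; multiplication by \<open>\<i>\<close> is then at once a
  left-invariant complex structure, constant in every chart of the group and of the quotient, and
  integrability costs nothing. What remains is the choice of \<open>A\<close>.

  Write \<open>\<omega>\<^sub>k\<close> for the left-invariant coframe of type \<open>(1,0)\<close>, that is, for the \<open>k\<close>-th coordinate of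
  \<open>A x\<close> inverted. The example is the nilpotent group with
    \<open>d\<omega>\<^sub>0 = 0\<close>, \<open>d\<omega>\<^sub>1 = \<omega>\<^sub>0 \<and> u\<close>, \<open>d\<omega>\<^sub>2 = 2 \<omega>\<^sub>1 \<and> u\<close>, \<open>d\<omega>\<^sub>3 = \<i> (\<omega>\<^sub>0 \<and> cnj \<omega>\<^sub>1 - \<omega>\<^sub>1 \<and> cnj \<omega>\<^sub>0)\<close>,
  where \<open>u = Re \<omega>\<^sub>3\<close> and all other \<open>\<omega>\<^sub>k\<close> are closed. The form \<open>d\<omega>\<^sub>3\<close> is purely imaginary, so \<open>u\<close> is closed;
  it is the differential of the homomorphism \<open>tau\<close> below.

  \<^item> The group is three-step nilpotent: brackets lead from \<open>\<omega>\<^sub>0, u\<close> to \<open>\<omega>\<^sub>1\<close> and from there to \<open>\<omega>\<^sub>2\<close> and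
    \<open>Im \<omega>\<^sub>3\<close> only (\<open>nilpotent_grp\<close>).

  \<^item> The complex structure is not nilpotent because it closes this chain to a cycle: it rotates the
    central direction of \<open>Im \<omega>\<^sub>3\<close> into that of \<open>u\<close>, which is responsible for the bracket from \<open>\<omega>\<^sub>0\<close> to
    \<open>\<omega>\<^sub>1\<close>. The ascending series therefore never gets beyond the directions of \<open>\<omega>\<^sub>2\<close> and of the
    abelian factor (\<open>non_nilpotent_J\<close>).

  \<^item> The forms \<open>\<i> \<omega>\<^sub>1 \<and> cnj \<omega>\<^sub>1\<close> and \<open>\<i> \<omega>\<^sub>3 \<and> cnj \<omega>\<^sub>3\<close>, needed for non-degeneracy, are not closed.
    Their differentials are combinations of \<open>\<omega>\<^sub>0 \<and> \<omega>\<^sub>3 \<and> cnj \<omega>\<^sub>1\<close> and \<open>\<omega>\<^sub>1 \<and> \<omega>\<^sub>3 \<and> cnj \<omega>\<^sub>0\<close> (and their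
    conjugates) with phases that do not cancel for any real coefficients. The coordinate \<open>\<omega>\<^sub>2\<close>,
    which enters no differential, is designed to absorb them: \<open>d (\<omega>\<^sub>0 \<and> cnj \<omega>\<^sub>2)\<close> is of the same
    kind, and its coefficient is an arbitrary complex number. With the coefficient
    \<open>1 + \<i>\<close> everything cancels (\<open>F0_torsion_cyclic\<close>), and \<open>\<omega>\<^sub>0\<close> is paired with \<open>\<omega>\<^sub>2\<close> as well.

  The polynomials in \<open>A\<close> have integer coefficients, so the points with Gaussian integer coordinates
  form a lattice. The remaining coordinates contribute a flat torus, which gives all \<open>n \<ge> 4\<close>.\<close>

section \<open>Smooth maps\<close>

lemma Ck_on_subset: "Ck_on k S f \<Longrightarrow> T \<subseteq> S \<Longrightarrow> Ck_on k T f"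
  by (induction k arbitrary: f) (auto intro: continuous_on_subset)

lemma smooth_on_subset: "smooth_on S f \<Longrightarrow> T \<subseteq> S \<Longrightarrow> smooth_on T f"
  unfolding smooth_on_def using Ck_on_subset by blast

lemma frechet_derivative_eq_on_open:
  assumes "open U" "x \<in> U" "\<And>y. y \<in> U \<Longrightarrow> f y = g y" "g differentiable (at x)"
  shows "f differentiable (at x)" "frechet_derivative f (at x) = frechet_derivative g (at x)"
proof -
  have "(g has_derivative frechet_derivative g (at x)) (at x)"
    using assms(4) by (simp add: frechet_derivative_works)
  then have *: "(f has_derivative frechet_derivative g (at x)) (at x)"
    using assms(1-3) has_derivative_transform_within_open by metis
  then show "f differentiable (at x)" by (auto simp: differentiable_def)
  show "frechet_derivative f (at x) = frechet_derivative g (at x)"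
    using frechet_derivative_at[OF *] by simp
qed

text \<open>Smoothness is a local property: a transition map of the quotient is not globally a left
  translation, but it agrees with one near each point.\<close>

lemma Ck_on_local:
  assumes "\<And>x. x \<in> S \<Longrightarrow> \<exists>U g. open U \<and> x \<in> U \<and> Ck_on k U g \<and> (\<forall>y\<in>U. f y = g y)"
  shows "Ck_on k S f"
  using assms
proof (induction k arbitrary: f)
  case 0
  have "continuous (at x within S) f" if x: "x \<in> S" for x
  proof -
    obtain U g where U: "open U" "x \<in> U" "continuous_on U g" "\<forall>y\<in>U. f y = g y"
      using 0[OF x] by auto
    then have "continuous_on U f" by (metis continuous_on_cong)
    then have "isCont f x" using U continuous_on_eq_continuous_at by blast
    then show ?thesis by (rule continuous_at_imp_continuous_within)
  qed
  then show ?case by (simp add: continuous_on_eq_continuous_within)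
next
  case (Suc k)
  have "f differentiable (at x)" if "x \<in> S" for x
    using Suc.prems[OF that] frechet_derivative_eq_on_open(1) by (metis Ck_on.simps(2))
  moreover have "Ck_on k S (\<lambda>x. frechet_derivative f (at x) v)" for v
  proof (rule Suc.IH)
    fix x assume "x \<in> S"
    then obtain U g where U: "open U" "x \<in> U" "Ck_on (Suc k) U g" "\<forall>y\<in>U. f y = g y"
      using Suc.prems by blast
    have "frechet_derivative f (at y) v = frechet_derivative g (at y) v" if "y \<in> U" for y
      using frechet_derivative_eq_on_open(2)[of U y f g] U that by simp
    then show "\<exists>U g. open U \<and> x \<in> U \<and> Ck_on k U g \<and>
        (\<forall>y\<in>U. frechet_derivative f (at y) v = g y)"
      using U by (intro exI[of _ U] exI[of _ "\<lambda>y. frechet_derivative g (at y) v"]) auto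
  qed
  ultimately show ?case by simp
qed

lemma smooth_on_local:
  assumes "\<And>x. x \<in> S \<Longrightarrow> \<exists>U g. open U \<and> x \<in> U \<and> smooth_on UNIV g \<and> (\<forall>y\<in>U. f y = g y)"
  shows "smooth_on S f"
  unfolding smooth_on_def
proof
  fix k show "Ck_on k S f"
  proof (rule Ck_on_local)
    fix x assume "x \<in> S"
    then show "\<exists>U g. open U \<and> x \<in> U \<and> Ck_on k U g \<and> (\<forall>y\<in>U. f y = g y)"
      using assms Ck_on_subset[OF _ subset_UNIV] unfolding smooth_on_def by metis
  qed
qed

lemma Ck_on_Suc_imp: "Ck_on (Suc k) S f \<Longrightarrow> Ck_on k S f"
proof (induction k arbitrary: f)
  case 0
  then have "\<forall>x\<in>S. f differentiable (at x)" by simp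
  then have "f differentiable_on S"
    by (simp add: differentiable_at_imp_differentiable_on)
  then show ?case by (simp add: differentiable_imp_continuous_on)
qed auto

lemma smooth_differentiable: "smooth_on S f \<Longrightarrow> x \<in> S \<Longrightarrow> f differentiable (at x)"
  unfolding smooth_on_def by (metis Ck_on.simps(2))

lemma smooth_continuous_on: "smooth_on S f \<Longrightarrow> continuous_on S f"
  unfolding smooth_on_def by (metis Ck_on.simps(1))

lemma smooth_has_derivative:
  "smooth_on S f \<Longrightarrow> x \<in> S \<Longrightarrow> (f has_derivative frechet_derivative f (at x)) (at x)"
  using smooth_differentiable frechet_derivative_works by blast

lemma Ck_const: "Ck_on k S (\<lambda>x. c)"
  by (induction k arbitrary: c) auto

lemma smooth_const [simp]: "smooth_on S (\<lambda>x. c)"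
  by (simp add: smooth_on_def Ck_const)

lemma frechet_derivative_bounded_linear:
  "bounded_linear f \<Longrightarrow> frechet_derivative f (at x) = f"
  by (metis bounded_linear_imp_has_derivative frechet_derivative_at)

lemma smooth_bounded_linear: "bounded_linear f \<Longrightarrow> smooth_on S f"
  unfolding smooth_on_def
proof
  fix k assume f: "bounded_linear f"
  show "Ck_on k S f"
  proof (cases k)
    case 0
    then show ?thesis using f by (simp add: linear_continuous_on)
  next
    case (Suc l)
    then show ?thesis
      using f by (simp add: frechet_derivative_bounded_linear Ck_const bounded_linear_imp_differentiable)
  qed
qed

lemma Ck_add:
  assumes "Ck_on k UNIV f" "Ck_on k UNIV g"
  shows "Ck_on k UNIV (\<lambda>x. f x + g x)"
  using assms
proof (induction k arbitrary: f g)
  case (Suc k)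
  have *: "((\<lambda>x. f x + g x) has_derivative
      (\<lambda>v. frechet_derivative f (at x) v + frechet_derivative g (at x) v)) (at x)" for x
    using Suc.prems by (intro has_derivative_add) (auto simp: frechet_derivative_works)
  have "frechet_derivative (\<lambda>x. f x + g x) (at x) v
      = frechet_derivative f (at x) v + frechet_derivative g (at x) v" for x v
    using frechet_derivative_at[OF *] by metis
  then show ?case using Suc differentiableI[OF *] by simp
qed (auto intro: continuous_on_add)

lemma smooth_add:
  "smooth_on UNIV f \<Longrightarrow> smooth_on UNIV g \<Longrightarrow> smooth_on UNIV (\<lambda>x. f x + g x)"
  by (simp add: smooth_on_def Ck_add)

lemma smooth_linear_compose:
  assumes "bounded_linear L" "smooth_on UNIV f"
  shows "smooth_on UNIV (\<lambda>x. L (f x))"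
proof -
  have "Ck_on k UNIV (\<lambda>x. L (f x))" if "Ck_on k UNIV f" for k
    using that
  proof (induction k arbitrary: f)
    case 0
    then show ?case
      using assms(1) by (simp add: bounded_linear.continuous_on)
  next
    case (Suc k)
    have *: "((\<lambda>x. L (f x)) has_derivative (\<lambda>v. L (frechet_derivative f (at x) v))) (at x)" for x
      using Suc.prems by (intro bounded_linear.has_derivative[OF assms(1)])
        (simp add: frechet_derivative_works[symmetric])
    have "frechet_derivative (\<lambda>x. L (f x)) (at x) v = L (frechet_derivative f (at x) v)" for x v
      using frechet_derivative_at[OF *] by metis
    then show ?case using Suc differentiableI[OF *] by simp
  qed
  then show ?thesis using assms(2-) by (simp add: smooth_on_def)
qed

text \<open>Precomposition with \<open>y \<mapsto> (x, y)\<close> or \<open>x \<mapsto> (x, v)\<close> freezes one argument of a jointly smooth map.\<close>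

lemma smooth_compose_affine:
  fixes L :: "'a::euclidean_space \<Rightarrow> 'b::euclidean_space"
  assumes "bounded_linear L" "smooth_on UNIV f"
  shows "smooth_on UNIV (\<lambda>x. f (L x + c))"
proof -
  have "Ck_on k UNIV (\<lambda>x. f (L x + c))" if "Ck_on k UNIV f" for k
    using that
  proof (induction k arbitrary: f)
    case 0
    then show ?case
      using assms(1) by (auto intro!: continuous_on_compose2[of UNIV f]
        simp: linear_continuous_on continuous_on_add)
  next
    case (Suc k)
    have L: "((\<lambda>x. L x + c) has_derivative L) (at x)" for x
      using bounded_linear_imp_has_derivative[OF assms(1)] has_derivative_add_const by blast
    have *: "((\<lambda>x. f (L x + c)) has_derivative (\<lambda>v. frechet_derivative f (at (L x + c)) (L v))) (at x)" for x
      using Suc.prems by (intro has_derivative_compose[OF L])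
        (simp add: frechet_derivative_works[symmetric])
    have "frechet_derivative (\<lambda>x. f (L x + c)) (at x) v = frechet_derivative f (at (L x + c)) (L v)" for x v
      using frechet_derivative_at[OF *] by metis
    moreover have "Ck_on k UNIV (\<lambda>x. frechet_derivative f (at (L x + c)) w)" for w
      using Suc.prems by (intro Suc.IH) simp
    ultimately show ?case using differentiableI[OF *] by simp
  qed
  then show ?thesis using assms(2-) by (simp add: smooth_on_def)
qed

lemma smooth_bilinear:
  assumes "bounded_bilinear h" "smooth_on UNIV f" "smooth_on UNIV g"
  shows "smooth_on UNIV (\<lambda>x. h (f x) (g x))"
proof -
  interpret h: bounded_bilinear h by fact
  have "Ck_on k UNIV (\<lambda>x. h (f x) (g x))"
    if "Ck_on k UNIV f" "Ck_on k UNIV g" for k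
    using that
  proof (induction k arbitrary: f g)
    case (Suc k)
    let ?df = "\<lambda>x v. frechet_derivative f (at x) v" and ?dg = "\<lambda>x v. frechet_derivative g (at x) v"
    have *: "((\<lambda>x. h (f x) (g x)) has_derivative (\<lambda>v. h (f x) (?dg x v) + h (?df x v) (g x))) (at x)" for x
      using Suc.prems by (intro h.FDERIV) (simp_all add: frechet_derivative_works[symmetric])
    have eq: "frechet_derivative (\<lambda>x. h (f x) (g x)) (at x) v = h (f x) (?dg x v) + h (?df x v) (g x)" for x v
      using frechet_derivative_at[OF *] by metis
    have "Ck_on k UNIV f" "Ck_on k UNIV g" using Suc.prems Ck_on_Suc_imp by blast+
    then have "Ck_on k UNIV (\<lambda>x. h (f x) (?dg x v) + h (?df x v) (g x))" for v
      using Suc by (intro Ck_add) auto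
    then show ?case using differentiableI[OF *] by (simp add: eq)
  qed (auto intro: h.continuous_on)
  then show ?thesis using assms(2-) by (simp add: smooth_on_def)
qed

lemma smooth_mult:
  fixes f g :: "'a::euclidean_space \<Rightarrow> 'b::real_normed_algebra"
  shows "smooth_on UNIV f \<Longrightarrow> smooth_on UNIV g \<Longrightarrow> smooth_on UNIV (\<lambda>x. f x * g x)"
  by (rule smooth_bilinear[OF bounded_bilinear_mult])

lemma smooth_minus: "smooth_on UNIV f \<Longrightarrow> smooth_on UNIV (\<lambda>x. - f x)"
  by (rule smooth_linear_compose[OF bounded_linear_minus[OF bounded_linear_ident]])

lemma smooth_diff: "smooth_on UNIV f \<Longrightarrow> smooth_on UNIV g \<Longrightarrow> smooth_on UNIV (\<lambda>x. f x - g x)"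
  using smooth_add[OF _ smooth_minus, of f g] by simp

lemma smooth_power2:
  fixes f :: "'a::euclidean_space \<Rightarrow> 'b::{real_normed_algebra,monoid_mult}"
  shows "smooth_on UNIV f \<Longrightarrow> smooth_on UNIV (\<lambda>x. (f x)\<^sup>2)"
  unfolding power2_eq_square by (intro smooth_mult)

lemma smooth_sum:
  "finite I \<Longrightarrow> (\<And>i. i \<in> I \<Longrightarrow> smooth_on UNIV (f i)) \<Longrightarrow> smooth_on UNIV (\<lambda>x. \<Sum>i\<in>I. f i x)"
  by (induction I rule: finite_induct) (auto intro: smooth_add)

lemma smooth_complex:
  "smooth_on UNIV f \<Longrightarrow> smooth_on UNIV (\<lambda>x. cnj (f x))"
  "smooth_on UNIV f \<Longrightarrow> smooth_on UNIV (\<lambda>x. Re (f x))"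
  "smooth_on UNIV f \<Longrightarrow> smooth_on UNIV (\<lambda>x. Im (f x))"
  "smooth_on UNIV g \<Longrightarrow> smooth_on UNIV (\<lambda>x. complex_of_real (g x))"
  by (rule smooth_linear_compose[OF bounded_linear_cnj] smooth_linear_compose[OF bounded_linear_Re]
      smooth_linear_compose[OF bounded_linear_Im] smooth_linear_compose[OF bounded_linear_of_real];
      assumption)+

lemmas smooth_intros = smooth_add smooth_diff smooth_minus smooth_mult smooth_power2 smooth_complex smooth_const

section \<open>Constant complex structures\<close>

text \<open>For constant \<open>J\<close> the derivatives of \<open>J X\<close> are \<open>J\<close> applied to those of \<open>X\<close>, and the terms of the
  Nijenhuis tensor cancel in pairs.\<close>

lemma complex_manifold_const:
  fixes M :: "('p, 'e::euclidean_space) mfd" and J :: "'e \<Rightarrow> 'e"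
  assumes M: "smooth_manifold M" and J: "linear J" "\<And>v. J (J v) = - v"
    and rel: "related_endo M M (\<lambda>p. p) (\<lambda>c x. J) (\<lambda>c x. J)"
  shows "complex_manifold M (\<lambda>c x. J)"
  unfolding complex_manifold_def
proof (intro conjI allI impI ballI)
  show "almost_complex_structure M (\<lambda>c x. J)"
    using J rel by (simp add: almost_complex_structure_def)
next
  fix X Y c x
  assume X: "vector_field M X" and Y: "vector_field M Y" and c: "c \<in> atlas M" and x: "x \<in> chart_ran c"
  have op: "open (chart_ran c)" using M c by (simp add: smooth_manifold_def)
  let ?E = "endo_app M (\<lambda>c x. J)" and ?D = "\<lambda>X. frechet_derivative (X c) (at x)"
  have D: "(X c has_derivative ?D X) (at x)" if "vector_field M X" for X
  proof -
    have "smooth_on (chart_ran c) (X c)" using that c by (simp add: vector_field_def)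
    then show ?thesis using smooth_has_derivative x by metis
  qed
  have DE: "frechet_derivative (?E X c) (at x) = (\<lambda>v. J (?D X v))" if X: "vector_field M X" for X
  proof -
    have bl: "bounded_linear J" using J(1) linear_conv_bounded_linear by blast
    have "((\<lambda>y. J (X c y)) has_derivative (\<lambda>v. J (?D X v))) (at x)"
      by (rule bounded_linear.has_derivative[OF bl D[OF X]])
    then have "(?E X c has_derivative (\<lambda>v. J (?D X v))) (at x)"
      by (rule has_derivative_transform_within_open[OF _ op x]) (simp add: endo_app_def c)
    then show ?thesis using frechet_derivative_at by metis
  qed
  have lin: "linear (?D X)" "linear (?D Y)"
    using D X Y has_derivative_linear by blast+
  have E: "?E X c x = J (X c x)" for X by (simp add: endo_app_def c x)
  show "lie_bracket M (?E X) (?E Y) c x - J (lie_bracket M (?E X) Y c x)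
      - J (lie_bracket M X (?E Y) c x) - lie_bracket M X Y c x = 0"
    by (simp add: lie_bracket_def c x DE X Y linear_diff[OF J(1)] J(2)
        E linear_neg[OF lin(1)] linear_neg[OF lin(2)])
qed (fact M)

section \<open>Simply transitive groups of affine transformations\<close>

definition affine_mfd :: "('e::euclidean_space, 'e) mfd" where
  "affine_mfd = \<lparr> mtop = euclidean, atlas = {(UNIV, \<lambda>x. x)} \<rparr>"

lemma global_chart [simp]:
  "chart_ran (UNIV, \<lambda>x. x) = UNIV" "chart_inv (UNIV, \<lambda>x. x) = (\<lambda>x. x)"
  by (auto simp: chart_ran_def chart_inv_def fun_eq_iff inv_into_f_f[of "\<lambda>x. x" UNIV, simplified])

lemma rep_global_chart [simp]:
  "rep f (UNIV, \<lambda>x. x) (UNIV, \<lambda>x. x) = f" "rep_dom f (UNIV, \<lambda>x. x) (UNIV, \<lambda>x. x) = UNIV"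
  by (auto simp: rep_def rep_dom_def)

lemma affine_mfd_simps [simp]:
  "mtop affine_mfd = euclidean" "atlas affine_mfd = {(UNIV, \<lambda>x. x)}"
  by (auto simp: affine_mfd_def)

lemma smooth_manifold_affine_mfd: "smooth_manifold (affine_mfd :: ('e::euclidean_space, 'e) mfd)"
proof -
  obtain B :: "'e set set" where B: "countable B" "topological_basis B"
    using ex_countable_basis by blast
  have "second_countable (euclidean :: 'e topology)"
    unfolding second_countable_def
  proof (intro exI[of _ B] conjI allI impI ballI)
    fix U and x :: 'e assume "openin euclidean U \<and> x \<in> U"
    then show "\<exists>V\<in>B. x \<in> V \<and> V \<subseteq> U"
      using topological_basisE[OF B(2)] by (metis open_openin)
  qed (use B topological_basis_open in auto)
  moreover have "homeomorphic_map (euclidean :: 'e topology) euclidean (\<lambda>x. x)"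
     using homeomorphic_map_id[of "euclidean :: 'e topology" euclidean] by (simp add: id_def)
  moreover have "smooth_on UNIV (\<lambda>x::'e. x)"
    by (rule smooth_bounded_linear) (rule bounded_linear_ident)
  ultimately show ?thesis
    by (simp add: smooth_manifold_def)
qed

text \<open>A straight-line homotopy between loops passes through loops.\<close>

lemma simply_connected_space_euclidean:
  "simply_connected_space (euclidean :: 'e::real_normed_vector topology)"
  unfolding simply_connected_space_def
proof (intro allI impI)
  fix p q :: "real \<Rightarrow> 'e"
  assume "pathin euclidean p \<and> p 1 = p 0 \<and> pathin euclidean q \<and> q 1 = q 0"
  then have c: "continuous_on {0..1} p" "continuous_on {0..1} q" and e: "p 1 = p 0" "q 1 = q 0"
    by (auto simp: pathin_def)
  let ?h = "\<lambda>z. (1 - fst z) *\<^sub>R p (snd z) + fst z *\<^sub>R q (snd z)"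
  have "continuous_on ({0..1} \<times> {0..1}) ?h"
    by (intro continuous_intros continuous_on_compose2[OF c(1)] continuous_on_compose2[OF c(2)]) auto
  then have "continuous_map (prod_topology (top_of_set {0..1}) (top_of_set {0..1})) euclidean ?h"
    by (simp add: prod_topology_subtopology_eu)
  then show "homotopic_with (\<lambda>r. r 1 = r 0) (top_of_set {0..1}) euclidean p q"
    unfolding homotopic_with_def using e by (intro exI[of _ ?h]) simp
qed

text \<open>Think of \<open>A x\<close> as the linear part of the affine map that moves \<open>0\<close> to \<open>x\<close>, and of \<open>B x\<close> as
  its inverse. The cocycle condition says that \<open>x \<mapsto> A x\<close> is a homomorphism for the multiplication
  \<open>x, y \<mapsto> x + A x y\<close>, which is what makes the latter associative. Smoothness of \<open>x \<mapsto> B x x\<close> is that of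
  the inversion.\<close>

locale affine_group =
  fixes A B :: "'e::euclidean_space \<Rightarrow> 'e \<Rightarrow> 'e"
  assumes linear_A: "linear (A x)"
    and A_cocycle: "A (x + A x y) z = A x (A y z)"
    and B_A: "B x (A x y) = y" and A_B: "A x (B x y) = y"
    and smooth_A: "smooth_on UNIV (\<lambda>p. A (fst p) (snd p))"
    and smooth_B: "smooth_on UNIV (\<lambda>x. B x x)"
begin

definition mul :: "'e \<Rightarrow> 'e \<Rightarrow> 'e" where "mul x y = x + A x y"
definition iv :: "'e \<Rightarrow> 'e" where "iv x = - B x x"
definition grp :: "'e monoid" where "grp = \<lparr>carrier = UNIV, mult = mul, one = 0\<rparr>"

lemma grp_simps [simp]: "carrier grp = UNIV" "x \<otimes>\<^bsub>grp\<^esub> y = mul x y" "\<one>\<^bsub>grp\<^esub> = 0"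
  by (auto simp: grp_def)

lemma A_mul: "A (mul x y) z = A x (A y z)"
  by (simp add: mul_def A_cocycle)

lemma A_0 [simp]: "A 0 x = x"
proof -
  have "A 0 (A 0 x) = A 0 x" using A_cocycle[of 0 0 x] linear_0[OF linear_A] by simp
  then show ?thesis using B_A by metis
qed

lemma linear_B: "linear (B x)"
proof
  show "B x (y + z) = B x y + B x z" for y z
    using A_B B_A linear_add[OF linear_A] by metis
  show "B x (c *\<^sub>R y) = c *\<^sub>R B x y" for c y
    using A_B B_A linear_scale[OF linear_A] by metis
qed

lemma mul_iv [simp]: "mul x (iv x) = 0"
  by (simp add: mul_def iv_def linear_neg[OF linear_A] A_B)

lemma A_iv: "A (iv x) y = B x y"
  using A_mul[of x "iv x" y] B_A by (metis mul_iv A_0)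

lemma iv_mul [simp]: "mul (iv x) x = 0"
  by (simp add: mul_def A_iv) (simp add: iv_def)

lemma mul_assoc: "mul (mul x y) z = mul x (mul y z)"
  by (simp add: mul_def A_cocycle linear_add[OF linear_A])

lemma mul_0 [simp]: "mul 0 x = x" "mul x 0 = x"
  by (simp_all add: mul_def linear_0[OF linear_A])

lemma mul_cancel [simp]: "mul (iv x) (mul x y) = y" "mul x (mul (iv x) y) = y"
  by (simp_all flip: mul_assoc)

lemma group_grp: "group grp"
  by (rule groupI) (auto simp: mul_assoc intro: iv_mul)

lemma inv_grp [simp]: "inv\<^bsub>grp\<^esub> x = iv x"
  by (rule group.inv_equality[OF group_grp]) auto

lemma smooth_mul: "smooth_on UNIV (\<lambda>p. mul (fst p) (snd p))"
  unfolding mul_def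
  by (intro smooth_add smooth_A smooth_bounded_linear bounded_linear_fst)

lemma smooth_iv: "smooth_on UNIV iv"
  unfolding iv_def
  by (rule smooth_linear_compose[OF bounded_linear_minus[OF bounded_linear_ident] smooth_B])

lemma smooth_mul_left: "smooth_on UNIV (mul g)"
  using smooth_compose_affine[OF _ smooth_mul, of "\<lambda>x. (0, x)" "(g, 0)"]
  by (simp add: bounded_linear_Pair bounded_linear_ident bounded_linear_zero)

lemma smooth_A_left: "smooth_on UNIV (\<lambda>x. A x v)"
  using smooth_compose_affine[OF _ smooth_A, of "\<lambda>x. (x, 0)" "(0, v)"]
  by (simp add: bounded_linear_Pair bounded_linear_ident bounded_linear_zero)

lemma continuous_mul:
  "continuous_on S f \<Longrightarrow> continuous_on S g \<Longrightarrow> continuous_on S (\<lambda>x. mul (f x) (g x))"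
  using continuous_on_compose2[OF smooth_continuous_on[OF smooth_mul], of S "\<lambda>x. (f x, g x)"]
  by (simp add: continuous_on_Pair)

lemma continuous_iv: "continuous_on S f \<Longrightarrow> continuous_on S (\<lambda>x. iv (f x))"
  using continuous_on_compose2[OF smooth_continuous_on[OF smooth_iv]] by auto

lemma mul_has_derivative: "(mul g has_derivative A g) (at x)"
  unfolding mul_def
  using has_derivative_add_const[of "A g" "A g" "at x" g]
    linear_imp_has_derivative[OF linear_A] by (simp add: add.commute)

lemma frechet_derivative_mul [simp]: "frechet_derivative (mul g) (at x) = A g"
  using frechet_derivative_at[OF mul_has_derivative] by simp

lemma lie_group: "lie_group grp affine_mfd"
proof -
  have "map_prod (\<lambda>x. x) (\<lambda>x. x) = (\<lambda>x::'e\<times>'e. x)" by (auto simp: fun_eq_iff)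
  then have at: "atlas (prod_mfd affine_mfd affine_mfd) = {(UNIV, \<lambda>x::'e\<times>'e. x)}"
    by (auto simp: prod_mfd_def)
  have tp: "mtop (prod_mfd affine_mfd affine_mfd) = (euclidean :: ('e\<times>'e) topology)"
    by (simp add: prod_mfd_def euclidean_product_topology)
  have "smooth_map (prod_mfd affine_mfd affine_mfd) affine_mfd (\<lambda>p. mul (fst p) (snd p))"
    by (simp add: smooth_map_def at tp smooth_mul smooth_continuous_on)
  moreover have "smooth_map affine_mfd affine_mfd iv"
    by (simp add: smooth_map_def smooth_iv smooth_continuous_on)
  ultimately show ?thesis
    by (simp add: lie_group_def group_grp smooth_manifold_affine_mfd case_prod_unfold)
qed

lemma left_invariant_complex_structure:
  assumes J: "linear J" "\<And>v. J (J v) = - v" "\<And>x v. A x (J v) = J (A x v)"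
  shows "left_invariant_complex_structure grp affine_mfd (\<lambda>c x. J)"
  unfolding left_invariant_complex_structure_def
proof
  have "frechet_derivative (\<lambda>x::'e. x) (at y) = (\<lambda>v. v)" for y :: 'e
    by (simp add: frechet_derivative_ident)
  then show "complex_manifold affine_mfd (\<lambda>c x. J)"
    using J by (intro complex_manifold_const smooth_manifold_affine_mfd) (auto simp: related_endo_def)
  have "(\<otimes>\<^bsub>grp\<^esub>) g = mul g" for g by (simp add: fun_eq_iff)
  then show "\<forall>g\<in>carrier grp. related_endo affine_mfd affine_mfd ((\<otimes>\<^bsub>grp\<^esub>) g) (\<lambda>c x. J) (\<lambda>c x. J)"
    using J by (simp add: related_endo_def)
qed

text \<open>The left-invariant vector field with value \<open>v\<close> at the identity. It takes the value \<open>0\<close> on pairs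
  that are not charts of the atlas, as vector fields have to.\<close>

definition inv_field :: "'e \<Rightarrow> ('e, 'e) vfield" where
  "inv_field v = (\<lambda>c x. if c = (UNIV, \<lambda>x. x) then A x v else 0)"

lemma inv_field_in_lie_algebra: "inv_field v \<in> lie_algebra grp affine_mfd"
proof -
  have "(\<otimes>\<^bsub>grp\<^esub>) g = mul g" for g by (simp add: fun_eq_iff)
  moreover have "frechet_derivative (\<lambda>x::'e. x) (at y) = (\<lambda>v. v)" for y :: 'e
    by (simp add: frechet_derivative_ident)
  ultimately show ?thesis
    by (auto simp: lie_algebra_def vector_field_def related_vf_def inv_field_def A_mul smooth_A_left)
qed

lemma lie_algebra_at:
  assumes "X \<in> lie_algebra grp affine_mfd"
  shows "X (UNIV, \<lambda>x. x) x = A x (X (UNIV, \<lambda>x. x) 0)"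
proof -
  have "(\<otimes>\<^bsub>grp\<^esub>) g = mul g" for g by (simp add: fun_eq_iff)
  then have "A x (X (UNIV, \<lambda>x. x) 0) = X (UNIV, \<lambda>x. x) (mul x 0)"
    using assms by (simp add: lie_algebra_def related_vf_def del: mul_0)
  then show ?thesis by simp
qed

text \<open>The bracket of the Lie algebra, transported to the tangent space at the identity.\<close>

definition brk :: "'e \<Rightarrow> 'e \<Rightarrow> 'e" where
  "brk u v = frechet_derivative (\<lambda>x. A x v) (at 0) u - frechet_derivative (\<lambda>x. A x u) (at 0) v"

lemma lie_bracket_at_0:
  assumes "\<And>x. X (UNIV, \<lambda>x. x) x = A x u" "\<And>x. Y (UNIV, \<lambda>x. x) x = A x v"
  shows "lie_bracket affine_mfd X Y (UNIV, \<lambda>x. x) 0 = brk u v"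
proof -
  have "X (UNIV, \<lambda>x. x) = (\<lambda>x. A x u)" "Y (UNIV, \<lambda>x. x) = (\<lambda>x. A x v)"
    using assms by auto
  then show ?thesis by (simp add: lie_bracket_def brk_def)
qed

text \<open>A proper subset \<open>W\<close> that contains every vector which is carried into \<open>W\<close> by all brackets with
  itself and its rotation is a barrier that the ascending series never crosses.\<close>

lemma non_nilpotent_structure:
  assumes J: "\<And>x v. A x (J v) = J (A x v)"
    and W: "0 \<in> W" "W \<noteq> UNIV"
    and stable: "\<And>u. (\<And>v. brk u v \<in> W) \<Longrightarrow> (\<And>v. brk (J u) v \<in> W) \<Longrightarrow> u \<in> W"
  shows "non_nilpotent_structure grp affine_mfd (\<lambda>c x. J)"
proof -
  let ?c = "(UNIV, \<lambda>x::'e. x)"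
  have asc: "X ?c 0 \<in> W" if "X \<in> asc_series grp affine_mfd (\<lambda>c x. J) t" for X t
    using that
  proof (induction t arbitrary: X)
    case (Suc t)
    define u where "u = X ?c 0"
    have X: "X ?c x = A x u" for x
      using Suc.prems lie_algebra_at unfolding u_def by simp
    have JX: "endo_app affine_mfd (\<lambda>c x. J) X ?c x = A x (J u)" for x
      by (simp add: endo_app_def X J)
    have Y: "inv_field v ?c x = A x v" for v x by (simp add: inv_field_def)
    have "lie_bracket affine_mfd (endo_app affine_mfd (\<lambda>c x. J) X) (inv_field v) ?c 0 = brk (J u) v" for v
      by (rule lie_bracket_at_0) (simp_all add: JX Y)
    note JXv = this
    have "brk u v \<in> W" for v
      using Suc.IH[of "lie_bracket affine_mfd X (inv_field v)"] Suc.prems inv_field_in_lie_algebra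
      by (simp add: lie_bracket_at_0[of X u "inv_field v" v, OF X Y])
    moreover have "brk (J u) v \<in> W" for v
      using Suc.IH[of "lie_bracket affine_mfd (endo_app affine_mfd (\<lambda>c x. J) X) (inv_field v)"]
        Suc.prems inv_field_in_lie_algebra
      by (simp add: JXv)
    ultimately show ?case using stable by (simp add: u_def)
  qed (use W in simp)
  obtain v where "v \<notin> W" using W by auto
  then have "inv_field v \<notin> asc_series grp affine_mfd (\<lambda>c x. J) t" for t
    using asc[of "inv_field v" t] by (auto simp: inv_field_def)
  then show ?thesis
    using inv_field_in_lie_algebra unfolding non_nilpotent_structure_def by metis
qed

end

section \<open>Quotients by lattices\<close>

text \<open>Cocompactness is expressed by a compact set \<open>K\<close> that meets every orbit.\<close>

locale affine_lattice = affine_group A B for A B :: "'e::euclidean_space \<Rightarrow> 'e \<Rightarrow> 'e" +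
  fixes \<Gamma> K :: "'e set"
  assumes subgroup_\<Gamma>: "subgroup \<Gamma> grp" and closed_\<Gamma>: "closed \<Gamma>"
    and discrete_\<Gamma>: "\<exists>U. open U \<and> 0 \<in> U \<and> \<Gamma> \<inter> U = {0}"
    and compact_K: "compact K" and cover_K: "\<exists>\<gamma>\<in>\<Gamma>. mul \<gamma> x \<in> K"
begin

definition proj :: "'e \<Rightarrow> 'e set" where "proj x = \<Gamma> #>\<^bsub>grp\<^esub> x"

abbreviation quot :: "('e set, 'e) mfd" where "quot \<equiv> quotient_mfd grp affine_mfd \<Gamma>"

lemma zero_\<Gamma>: "0 \<in> \<Gamma>"
  using subgroup.one_closed[OF subgroup_\<Gamma>] by simp

lemma mul_\<Gamma>: "x \<in> \<Gamma> \<Longrightarrow> y \<in> \<Gamma> \<Longrightarrow> mul x y \<in> \<Gamma>"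
  using subgroup.m_closed[OF subgroup_\<Gamma>] by simp

lemma iv_\<Gamma>: "x \<in> \<Gamma> \<Longrightarrow> iv x \<in> \<Gamma>"
  using subgroup.m_inv_closed[OF subgroup_\<Gamma>] by simp

lemma proj_eq: "proj x = (\<lambda>\<gamma>. mul \<gamma> x) ` \<Gamma>"
  by (auto simp: proj_def r_coset_def)

lemma proj_eq_iff: "proj x = proj y \<longleftrightarrow> (\<exists>\<gamma>\<in>\<Gamma>. y = mul \<gamma> x)"
proof
  assume "proj x = proj y"
  moreover have "y \<in> proj y" unfolding proj_eq using zero_\<Gamma> by (intro image_eqI[of _ _ 0]) simp_all
  ultimately show "\<exists>\<gamma>\<in>\<Gamma>. y = mul \<gamma> x" by (auto simp: proj_eq)
next
  assume "\<exists>\<gamma>\<in>\<Gamma>. y = mul \<gamma> x"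
  then obtain \<gamma> where \<gamma>: "\<gamma> \<in> \<Gamma>" "y = mul \<gamma> x" by blast
  show "proj x = proj y"
  proof
    show "proj x \<subseteq> proj y"
      unfolding proj_eq
    proof (rule image_subsetI)
      fix \<delta> assume "\<delta> \<in> \<Gamma>"
      then have "mul \<delta> (iv \<gamma>) \<in> \<Gamma>" using \<gamma>(1) by (intro mul_\<Gamma> iv_\<Gamma>)
      moreover have "mul \<delta> x = mul (mul \<delta> (iv \<gamma>)) y" by (simp add: \<gamma>(2) mul_assoc)
      ultimately show "mul \<delta> x \<in> (\<lambda>\<gamma>. mul \<gamma> y) ` \<Gamma>" by (metis imageI)
    qed
    show "proj y \<subseteq> proj x"
      unfolding proj_eq \<gamma>(2) using \<gamma>(1) mul_\<Gamma> by (auto simp flip: mul_assoc)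
  qed
qed

lemma proj_mul: "\<gamma> \<in> \<Gamma> \<Longrightarrow> proj (mul \<gamma> x) = proj x"
  using proj_eq_iff by metis

lemma openin_quot: "openin (mtop quot) U \<longleftrightarrow> U \<subseteq> range proj \<and> open {g. proj g \<in> U}"
proof -
  have "rcosets\<^bsub>grp\<^esub> \<Gamma> = range proj"
    by (auto simp: RCOSETS_def proj_def)
  then show ?thesis by (simp add: openin_quotient_mfd proj_def)
qed

lemma topspace_quot: "topspace (mtop quot) = range proj"
proof
  show "topspace (mtop quot) \<subseteq> range proj"
    using openin_quot openin_topspace by blast
  show "range proj \<subseteq> topspace (mtop quot)"
    using openin_quot by (intro openin_subset) simp
qed

lemma continuous_map_proj: "continuous_map euclidean (mtop quot) proj"
  by (auto simp: continuous_map topspace_quot openin_quot)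

lemma open_mul_vimage: "open W \<Longrightarrow> open {y. mul g y \<in> W}"
  using continuous_on_open_vimage[of UNIV "mul g"] smooth_continuous_on[OF smooth_mul_left]
  by (simp add: vimage_def)

lemma openin_proj_image: assumes "open W" shows "openin (mtop quot) (proj ` W)"
proof -
  have "{g. proj g \<in> proj ` W} = (\<Union>\<gamma>\<in>\<Gamma>. {y. mul \<gamma> y \<in> W})"
    by (auto simp: proj_eq_iff proj_mul image_iff)
  then have "open {g. proj g \<in> proj ` W}"
    using open_mul_vimage[OF assms] by auto
  then show ?thesis by (auto simp: openin_quot)
qed

lemma open_map_proj: "open_map euclidean (mtop quot) proj"
  by (simp add: open_map_def openin_proj_image)

text \<open>The continuous function \<open>mul v (iv u)\<close> recovers the element that translates \<open>u\<close> to \<open>v\<close>. Applied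
  to a small neighbourhood of \<open>0\<close> the lemma separates \<open>\<Gamma>\<close>-translates of a point, applied to the
  complement of \<open>\<Gamma>\<close> it separates orbits.\<close>

lemma quotient_nbhds:
  assumes "open S" "mul y (iv x) \<in> S"
  obtains U V where "open U" "open V" "x \<in> U" "y \<in> V"
    "\<And>u v \<gamma>. u \<in> U \<Longrightarrow> v \<in> V \<Longrightarrow> v = mul \<gamma> u \<Longrightarrow> \<gamma> \<in> S"
proof -
  let ?f = "\<lambda>p. mul (snd p) (iv (fst p))"
  have "continuous_on UNIV ?f"
    by (intro continuous_mul continuous_iv continuous_intros)
  then have "open (?f -` S)" using assms(1) open_vimage by blast
  then obtain U V where UV: "open U" "open V" "(x, y) \<in> U \<times> V" "U \<times> V \<subseteq> ?f -` S"
    using open_prod_elim[of "?f -` S" "(x, y)"] assms(2) by auto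
  have "\<gamma> \<in> S" if "u \<in> U" "v \<in> V" "v = mul \<gamma> u" for u v \<gamma>
  proof -
    have "mul v (iv u) \<in> S" using that UV(4) by fastforce
    then show ?thesis by (simp add: that(3) mul_assoc)
  qed
  then show ?thesis using that UV(1-3) by blast
qed

lemma locally_injective: "\<exists>W. open W \<and> x \<in> W \<and> inj_on proj W"
proof -
  obtain S where S: "open S" "0 \<in> S" "\<Gamma> \<inter> S = {0}" using discrete_\<Gamma> by blast
  have "mul x (iv x) \<in> S" using S(2) by simp
  then obtain U V where UV: "open U" "open V" "x \<in> U" "x \<in> V"
    "\<And>u v \<gamma>. u \<in> U \<Longrightarrow> v \<in> V \<Longrightarrow> v = mul \<gamma> u \<Longrightarrow> \<gamma> \<in> S"
    by (rule quotient_nbhds[OF S(1)]) (rule that)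
  have "u = v" if "u \<in> U \<inter> V" "v \<in> U \<inter> V" "proj u = proj v" for u v
  proof -
    obtain \<gamma> where \<gamma>: "\<gamma> \<in> \<Gamma>" "v = mul \<gamma> u" using \<open>proj u = proj v\<close> proj_eq_iff by blast
    then have "\<gamma> \<in> S" using that by (intro UV(5)[of u v]) auto
    then have "\<gamma> = 0" using S(3) \<gamma>(1) by blast
    then show ?thesis using \<gamma>(2) by simp
  qed
  then show ?thesis using UV by (intro exI[of _ "U \<inter> V"]) (auto intro: inj_onI)
qed

lemma Hausdorff_quot: "Hausdorff_space (mtop quot)"
  unfolding Hausdorff_space_def
proof (intro allI impI)
  fix p q assume pq: "p \<in> topspace (mtop quot) \<and> q \<in> topspace (mtop quot) \<and> p \<noteq> q"
  then obtain x y where xy: "p = proj x" "q = proj y" by (auto simp: topspace_quot)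
  have "mul y (iv x) \<notin> \<Gamma>"
  proof
    assume "mul y (iv x) \<in> \<Gamma>"
    moreover have "y = mul (mul y (iv x)) x" by (simp add: mul_assoc)
    ultimately have "proj x = proj y" using proj_eq_iff by blast
    then show False using pq xy by simp
  qed
  then have "mul y (iv x) \<in> - \<Gamma>" by simp
  then obtain U V where UV: "open U" "open V" "x \<in> U" "y \<in> V"
    "\<And>u v \<gamma>. u \<in> U \<Longrightarrow> v \<in> V \<Longrightarrow> v = mul \<gamma> u \<Longrightarrow> \<gamma> \<in> - \<Gamma>"
    by (rule quotient_nbhds[OF open_Compl[OF closed_\<Gamma>]]) (rule that)
  have "proj u \<noteq> proj v" if "u \<in> U" "v \<in> V" for u v
    using UV(5)[OF that] proj_eq_iff[of u v] by auto
  then have "disjnt (proj ` U) (proj ` V)"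
    by (auto simp: disjnt_iff)
  then show "\<exists>U V. openin (mtop quot) U \<and> openin (mtop quot) V \<and> p \<in> U \<and> q \<in> V \<and> disjnt U V"
    using UV(1-4) openin_proj_image xy by blast
qed

lemma second_countable_quot: "second_countable (mtop quot)"
  using second_countable_open_map_image[OF continuous_map_proj open_map_proj]
    smooth_manifold_affine_mfd[where 'e='e] by (simp add: topspace_quot smooth_manifold_def)

lemma compact_quot: "compact_space (mtop quot)"
proof -
  have "proj ` K = range proj"
    using cover_K proj_mul by (auto simp: image_iff) (metis)
  then show ?thesis
    using image_compactin[OF _ continuous_map_proj, of K] compact_K
    by (simp add: compact_space_def topspace_quot)
qed

subsection \<open>Charts of the quotient\<close>

definition qchart :: "'e set \<Rightarrow> ('e set, 'e) chart" where
  "qchart W = (proj ` W, inv_into W proj)"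

lemma atlas_quot: "atlas quot = {qchart W | W. open W \<and> inj_on proj W}"
proof -
  have "(\<lambda>g. \<Gamma> #>\<^bsub>grp\<^esub> g) = proj" by (simp add: fun_eq_iff proj_def)
  then show ?thesis
    by (simp add: quotient_mfd_def qchart_def)
qed

lemma qchart_simps [simp]: "fst (qchart W) = proj ` W" "snd (qchart W) = inv_into W proj"
  by (simp_all add: qchart_def)

lemma chart_ran_qchart [simp]: "inj_on proj W \<Longrightarrow> chart_ran (qchart W) = W"
  by (simp add: chart_ran_def image_image)

lemma chart_inv_qchart [simp]:
  assumes "inj_on proj W" "x \<in> W"
  shows "chart_inv (qchart W) x = proj x"
proof -
  have "inj_on (inv_into W proj) (proj ` W)" by (rule inj_on_inv_into) simp
  then show ?thesis
    using inv_into_f_f[of "inv_into W proj" "proj ` W" "proj x"] assms by (simp add: chart_inv_def)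
qed

text \<open>The chart of \<open>V\<close> sends \<open>proj y\<close> to the translate of \<open>y\<close> in \<open>V\<close>. The translating element found at
  \<open>x\<close> also moves nearby points into \<open>V\<close>, hence is the right one for them by injectivity.\<close>

lemma local_translation:
  assumes "inj_on proj V" "open V" "proj x \<in> proj ` V"
  shows "\<exists>\<gamma>\<in>\<Gamma>. \<exists>U. open U \<and> x \<in> U \<and> (\<forall>y\<in>U. inv_into V proj (proj y) = mul \<gamma> y)"
proof -
  obtain z where z: "z \<in> V" "proj x = proj z" using assms by auto
  then obtain \<gamma> where \<gamma>: "\<gamma> \<in> \<Gamma>" "z = mul \<gamma> x" using proj_eq_iff by blast
  have "inv_into V proj (proj y) = mul \<gamma> y" if "mul \<gamma> y \<in> V" for y
    using inv_into_f_f[OF assms(1) that] proj_mul[OF \<gamma>(1)] by simp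
  then show ?thesis
    using \<gamma> z open_mul_vimage[OF assms(2), of \<gamma>]
    by (intro bexI[of _ \<gamma>] exI[of _ "{y. mul \<gamma> y \<in> V}"]) auto
qed

lemma transition_local:
  assumes "inj_on proj W" "open W" "inj_on proj V" "open V"
    and "x \<in> rep_dom (\<lambda>p. p) (qchart W) (qchart V)"
  shows "\<exists>\<gamma>\<in>\<Gamma>. \<exists>U. open U \<and> x \<in> U \<and> (\<forall>y\<in>U. rep (\<lambda>p. p) (qchart W) (qchart V) y = mul \<gamma> y)"
proof -
  have x: "x \<in> W" "proj x \<in> proj ` V" using assms by (auto simp: rep_dom_def)
  then obtain \<gamma> U where "\<gamma> \<in> \<Gamma>" "open U" "x \<in> U" "\<forall>y\<in>U. inv_into V proj (proj y) = mul \<gamma> y"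
    using local_translation[OF assms(3,4)] by meson
  then show ?thesis
    using x assms(1,2) by (intro bexI[of _ \<gamma>] exI[of _ "U \<inter> W"]) (auto simp: rep_def)
qed

lemma projection_local:
  assumes "inj_on proj V" "open V" "x \<in> rep_dom proj (UNIV, \<lambda>x. x) (qchart V)"
  shows "\<exists>\<gamma>\<in>\<Gamma>. \<exists>U. open U \<and> x \<in> U \<and> (\<forall>y\<in>U. rep proj (UNIV, \<lambda>x. x) (qchart V) y = mul \<gamma> y)"
  using local_translation[OF assms(1,2)] assms(3) by (simp add: rep_def rep_dom_def)

lemma frechet_derivative_local_mul:
  assumes "open U" "x \<in> U" "\<forall>y\<in>U. f y = mul \<gamma> y"
  shows "frechet_derivative f (at x) = A \<gamma>"
  using frechet_derivative_eq_on_open(2)[OF assms(1,2), of f "mul \<gamma>"] assms(3)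
    differentiableI[OF mul_has_derivative[of \<gamma> x]]
  by simp

lemma transition_derivative:
  assumes "c \<in> atlas quot" "d \<in> atlas quot" "x \<in> rep_dom (\<lambda>p. p) c d"
  shows "\<exists>\<gamma>\<in>\<Gamma>. rep (\<lambda>p. p) c d x = mul \<gamma> x \<and> frechet_derivative (rep (\<lambda>p. p) c d) (at x) = A \<gamma>"
proof -
  obtain W V where "c = qchart W" "d = qchart V" "inj_on proj W" "open W" "inj_on proj V" "open V"
    using assms by (auto simp: atlas_quot)
  then obtain \<gamma> U where "\<gamma> \<in> \<Gamma>" "open U" "x \<in> U" "\<forall>y\<in>U. rep (\<lambda>p. p) c d y = mul \<gamma> y"
    using transition_local assms(3) by meson
  then show ?thesis using frechet_derivative_local_mul by blast
qed

lemma homeomorphic_qchart: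
  assumes "open W" "inj_on proj W"
  shows "homeomorphic_map (subtopology (mtop quot) (proj ` W)) (top_of_set W) (inv_into W proj)"
proof -
  let ?Q = "subtopology (mtop quot) (proj ` W)"
  have tQ: "topspace ?Q = proj ` W" by (auto simp: topspace_quot)
  have "homeomorphic_map (top_of_set W) ?Q proj"
  proof (rule bijective_open_imp_homeomorphic_map)
    show "continuous_map (top_of_set W) ?Q proj"
      using continuous_map_from_subtopology[OF continuous_map_proj]
      by (auto simp: continuous_map_in_subtopology)
    show "open_map (top_of_set W) ?Q proj"
    proof (unfold open_map_def, intro allI impI)
      fix U assume "openin (top_of_set W) U"
      then have "open U" "U \<subseteq> W" using assms(1) by (auto simp: openin_open_eq)
      then show "openin ?Q (proj ` U)"
        using openin_proj_image by (auto simp: openin_subtopology intro!: exI[of _ "proj ` U"])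
    qed
  qed (use assms tQ in auto)
  then obtain g where g: "homeomorphic_maps (top_of_set W) ?Q proj g"
    using homeomorphic_map_maps by blast
  then have "homeomorphic_map ?Q (top_of_set W) g"
    using homeomorphic_maps_map by blast
  moreover have "g q = inv_into W proj q" if "q \<in> topspace ?Q" for q
    using that g assms(2) unfolding tQ homeomorphic_maps_def by (auto simp: inv_into_f_f)
  ultimately show ?thesis by (rule homeomorphic_map_eq)
qed

lemma smooth_manifold_quot: "smooth_manifold quot"
  unfolding smooth_manifold_def
proof (intro conjI ballI)
  show "(\<Union>c\<in>atlas quot. fst c) = topspace (mtop quot)"
  proof
    show "(\<Union>c\<in>atlas quot. fst c) \<subseteq> topspace (mtop quot)" by (auto simp: atlas_quot topspace_quot)
    show "topspace (mtop quot) \<subseteq> (\<Union>c\<in>atlas quot. fst c)"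
    proof
      fix q assume "q \<in> topspace (mtop quot)"
      then obtain x where "q = proj x" by (auto simp: topspace_quot)
      moreover obtain W where "open W" "x \<in> W" "inj_on proj W" using locally_injective by blast
      ultimately show "q \<in> (\<Union>c\<in>atlas quot. fst c)"
        by (intro UN_I[of "qchart W"]) (auto simp: atlas_quot)
    qed
  qed
next
  fix c d assume "c \<in> atlas quot" "d \<in> atlas quot"
  then obtain W V where cd: "c = qchart W" "d = qchart V" "inj_on proj W" "open W" "inj_on proj V" "open V"
    by (auto simp: atlas_quot)
  show "smooth_on (rep_dom (\<lambda>p. p) c d) (rep (\<lambda>p. p) c d)"
  proof (rule smooth_on_local)
    fix x assume "x \<in> rep_dom (\<lambda>p. p) c d"
    then obtain \<gamma> U where "open U" "x \<in> U" "\<forall>y\<in>U. rep (\<lambda>p. p) c d y = mul \<gamma> y"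
      using transition_local cd by meson
    then show "\<exists>U g. open U \<and> x \<in> U \<and> smooth_on UNIV g \<and> (\<forall>y\<in>U. rep (\<lambda>p. p) c d y = g y)"
      using smooth_mul_left by blast
  qed
qed (auto simp: atlas_quot Hausdorff_quot second_countable_quot openin_proj_image homeomorphic_qchart)

lemma nilmanifold:
  assumes "nilpotent_group grp"
  shows "nilmanifold grp affine_mfd \<Gamma>"
proof -
  obtain S where S: "open S" "0 \<in> S" "\<Gamma> \<inter> S = {0}" using discrete_\<Gamma> by blast
  have "openin (top_of_set \<Gamma>) {\<gamma>}" if \<gamma>: "\<gamma> \<in> \<Gamma>" for \<gamma>
  proof -
    have "\<delta> = \<gamma>" if "\<delta> \<in> \<Gamma>" "mul (iv \<gamma>) \<delta> \<in> S" for \<delta>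
    proof -
      have "mul (iv \<gamma>) \<delta> = 0" using S(3) that mul_\<Gamma> iv_\<Gamma> \<gamma> by blast
      then show ?thesis using mul_cancel(2)[of \<gamma> \<delta>] by simp
    qed
    moreover have "mul (iv \<gamma>) \<gamma> \<in> S" using S(2) by simp
    ultimately have "{\<gamma>} = \<Gamma> \<inter> {y. mul (iv \<gamma>) y \<in> S}" using \<gamma> by blast
    then show ?thesis using open_mul_vimage[OF S(1), of "iv \<gamma>"] by (auto simp: openin_open)
  qed
  then have "subtopology euclidean \<Gamma> = discrete_topology \<Gamma>"
    by (subst eq_commute, subst discrete_topology_unique) simp
  moreover have "connected_space (euclidean :: 'e topology)"
    using connected_UNIV[where 'a='e] by (metis connectedin_iff_connected connectedin_topspace topspace_euclidean)
  ultimately show ?thesis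
    using assms lie_group simply_connected_space_euclidean[where 'e='e] subgroup_\<Gamma> compact_quot
    by (simp add: nilmanifold_def)
qed

lemma induced_complex_structure:
  assumes J: "linear J" "\<And>v. J (J v) = - v" "\<And>x v. A x (J v) = J (A x v)"
  shows "induced_complex_structure grp affine_mfd \<Gamma> (\<lambda>c x. J) (\<lambda>c x. J)"
  unfolding induced_complex_structure_def
proof
  have "related_endo quot quot (\<lambda>p. p) (\<lambda>c x. J) (\<lambda>c x. J)"
    unfolding related_endo_def using transition_derivative J(3) by metis
  then show "complex_manifold quot (\<lambda>c x. J)"
    using J smooth_manifold_quot by (intro complex_manifold_const)
  have "frechet_derivative (rep proj (UNIV, \<lambda>x. x) d) (at x) (J v)
      = J (frechet_derivative (rep proj (UNIV, \<lambda>x. x) d) (at x) v)"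
    if d: "d \<in> atlas quot" and x: "x \<in> rep_dom proj (UNIV, \<lambda>x. x) d" for d x v
  proof -
    obtain V where "d = qchart V" "inj_on proj V" "open V" using d by (auto simp: atlas_quot)
    then obtain \<gamma> U where "open U" "x \<in> U" "\<forall>y\<in>U. rep proj (UNIV, \<lambda>x. x) d y = mul \<gamma> y"
      using projection_local x by meson
    then have "frechet_derivative (rep proj (UNIV, \<lambda>x. x) d) (at x) = A \<gamma>"
      by (rule frechet_derivative_local_mul)
    then show ?thesis by (simp add: J(3))
  qed
  then show "related_endo affine_mfd quot (\<lambda>g. \<Gamma> #>\<^bsub>grp\<^esub> g) (\<lambda>c x. J) (\<lambda>c x. J)"
    unfolding related_endo_def proj_def[abs_def] by simp
qed

text \<open>A form whose coefficients are constant in the left-invariant frame is invariant under left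
  translations, hence descends to the quotient. There its value in any chart is given by the same
  formula as on the group.\<close>

lemma pseudo_kaehler_metric:
  assumes F: "bilinear F" "\<And>u v. F u v = - F v u" "\<And>u. (\<And>v. F u v = 0) \<Longrightarrow> u = 0"
    and J: "\<And>x v. A x (J v) = J (A x v)" "\<And>u v. F (J u) (J v) = F u v"
    and smooth: "\<And>u v. smooth_on UNIV (\<lambda>x. F (B x u) (B x v))"
    and closed: "\<And>x u v w. frechet_derivative (\<lambda>y. F (B y v) (B y w)) (at x) u
        - frechet_derivative (\<lambda>y. F (B y u) (B y w)) (at x) v
        + frechet_derivative (\<lambda>y. F (B y u) (B y v)) (at x) w = 0"
  shows "pseudo_kaehler_metric quot (\<lambda>c x. J) (\<lambda>c x u v. F (B x u) (B x v))"
  unfolding pseudo_kaehler_metric_def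
proof (intro conjI ballI allI)
  have JB: "B x (J v) = J (B x v)" for x v
    by (metis J(1) A_B B_A)
  then show "F (B x (J u)) (B x (J v)) = F (B x u) (B x v)" for x u v
    by (simp add: J(2))
  show "closed_form2 quot (\<lambda>c x u v. F (B x u) (B x v))"
    by (simp add: closed_form2_def closed)
  show "nondegenerate_form2 quot (\<lambda>c x u v. F (B x u) (B x v))"
    unfolding nondegenerate_form2_def
  proof (intro ballI allI impI)
    fix x u assume "\<forall>v. F (B x u) (B x v) = 0"
    then have "F (B x u) v = 0" for v using B_A by metis
    then have "B x u = 0" by (rule F(3))
    then show "u = 0" using A_B[of x u] linear_0[OF linear_A] by simp
  qed
  have "B (mul \<gamma> x) (A \<gamma> u) = B x u" for \<gamma> x u
    by (metis A_mul A_B B_A)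
  then have "related_form2 quot quot (\<lambda>p. p) (\<lambda>c x u v. F (B x u) (B x v)) (\<lambda>c x u v. F (B x u) (B x v))"
    unfolding related_form2_def using transition_derivative by metis
  moreover have "bilinear (\<lambda>u v. F (B x u) (B x v))" for x
    unfolding bilinear_def
  proof (intro conjI allI)
    show "linear (\<lambda>v. F (B x u) (B x v))" for u
      using linear_compose[OF linear_B, of "F (B x u)"] F(1) by (simp add: bilinear_def o_def)
    show "linear (\<lambda>u. F (B x u) (B x v))" for v
      using linear_compose[OF linear_B, of "\<lambda>u. F u (B x v)"] F(1) by (simp add: bilinear_def o_def)
  qed
  moreover have "smooth_on S (\<lambda>x. F (B x u) (B x v))" for S u v
    using smooth_on_subset[OF smooth] by simp
  ultimately show "two_form quot (\<lambda>c x u v. F (B x u) (B x v))"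
    unfolding two_form_def using F(2) by blast
qed

end

section \<open>A three-step nilpotent group of complex affine transformations\<close>

definition gauss_ints :: "complex set" where
  "gauss_ints = {w. Re w \<in> \<int> \<and> Im w \<in> \<int>}"

lemma gauss_ints_intros [simp, intro]:
  "0 \<in> gauss_ints" "\<i> \<in> gauss_ints" "numeral m \<in> gauss_ints"
  "a \<in> gauss_ints \<Longrightarrow> - a \<in> gauss_ints"
  "a \<in> gauss_ints \<Longrightarrow> cnj a \<in> gauss_ints"
  "t \<in> \<int> \<Longrightarrow> complex_of_real t \<in> gauss_ints"
  "a \<in> gauss_ints \<Longrightarrow> b \<in> gauss_ints \<Longrightarrow> a + b \<in> gauss_ints"
  "a \<in> gauss_ints \<Longrightarrow> b \<in> gauss_ints \<Longrightarrow> a - b \<in> gauss_ints"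
  "a \<in> gauss_ints \<Longrightarrow> b \<in> gauss_ints \<Longrightarrow> a * b \<in> gauss_ints"
  "a \<in> gauss_ints \<Longrightarrow> a\<^sup>2 \<in> gauss_ints"
  by (auto simp: gauss_ints_def power2_eq_square)

lemma closed_gauss_ints: "closed gauss_ints"
proof -
  have "gauss_ints = Re -` \<int> \<inter> Im -` \<int>" by (auto simp: gauss_ints_def)
  moreover have "closed (Re -` \<int>)" "closed (Im -` \<int>)"
    by (intro closed_vimage closed_Ints continuous_intros)+
  ultimately show ?thesis by (metis closed_Int)
qed

text \<open>A translation that moves \<open>w\<close> into the unit square.\<close>

definition round_off :: "complex \<Rightarrow> complex" where
  "round_off w = Complex (- real_of_int \<lfloor>Re w\<rfloor>) (- real_of_int \<lfloor>Im w\<rfloor>)"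

lemma round_off: "round_off w \<in> gauss_ints" "cmod (w + round_off w) \<le> 2"
proof -
  show "round_off w \<in> gauss_ints" by (simp add: gauss_ints_def round_off_def)
  have "\<bar>Re (w + round_off w)\<bar> \<le> 1" "\<bar>Im (w + round_off w)\<bar> \<le> 1"
    by (simp add: round_off_def, linarith)+
  then show "cmod (w + round_off w) \<le> 2"
    using cmod_le[of "w + round_off w"] by linarith
qed

(* keeps the coordinate index 1 in the form in which the coordinate lemmas mention it *)
declare One_nat_def [simp del]

text \<open>Complex coordinates on a real space: \<open>Z k\<close> reads off the \<open>k\<close>-th coordinate, \<open>e k\<close> embeds the
  \<open>k\<close>-th axis.\<close>

locale complex_coordinates =
  fixes Z :: "nat \<Rightarrow> 'e::euclidean_space \<Rightarrow> complex" and e :: "nat \<Rightarrow> complex \<Rightarrow> 'e" and n :: nat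
  assumes n: "4 \<le> n"
    and bl_Z: "bounded_linear (Z k)" and bl_e: "bounded_linear (e k)"
    and Z_e: "j < n \<Longrightarrow> k < n \<Longrightarrow> Z j (e k w) = (if j = k then w else 0)"
    and Z_inj: "(\<And>k. k < n \<Longrightarrow> Z k x = 0) \<Longrightarrow> x = 0"
begin

lemma Z_linear [simp]:
  "Z k (x + y) = Z k x + Z k y" "Z k (x - y) = Z k x - Z k y" "Z k (- x) = - Z k x"
  "Z k 0 = 0" "Z k (r *\<^sub>R x) = r *\<^sub>R Z k x"
  using bounded_linear.linear[OF bl_Z[of k]]
  by (simp_all add: linear_add linear_diff linear_neg linear_0 linear_scale)

lemma Z_e_simps [simp]:
  "Z 0 (e 1 w) = 0" "Z 0 (e 2 w) = 0" "Z 0 (e 3 w) = 0" "Z 0 (e 0 w) = w"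
  "Z 1 (e 0 w) = 0" "Z 1 (e 2 w) = 0" "Z 1 (e 3 w) = 0" "Z 1 (e 1 w) = w"
  "Z 2 (e 0 w) = 0" "Z 2 (e 1 w) = 0" "Z 2 (e 3 w) = 0" "Z 2 (e 2 w) = w"
  "Z 3 (e 0 w) = 0" "Z 3 (e 1 w) = 0" "Z 3 (e 2 w) = 0" "Z 3 (e 3 w) = w"
  "4 \<le> k \<Longrightarrow> k < n \<Longrightarrow> Z k (e 0 w) = 0" "4 \<le> k \<Longrightarrow> k < n \<Longrightarrow> Z k (e 1 w) = 0"
  "4 \<le> k \<Longrightarrow> k < n \<Longrightarrow> Z k (e 2 w) = 0" "4 \<le> k \<Longrightarrow> k < n \<Longrightarrow> Z k (e 3 w) = 0"
  using n by (simp_all add: Z_e)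

lemma less_n_cases: "k < n \<Longrightarrow> k = 0 \<or> k = 1 \<or> k = 2 \<or> k = 3 \<or> (4 \<le> k \<and> k < n)"
  by linarith

lemma coord_eqI:
  assumes "Z 0 x = Z 0 y" "Z 1 x = Z 1 y" "Z 2 x = Z 2 y" "Z 3 x = Z 3 y"
    and "\<And>k. 4 \<le> k \<Longrightarrow> k < n \<Longrightarrow> Z k x = Z k y"
  shows "x = y"
proof -
  have "Z k (x - y) = 0" if "k < n" for k
    using less_n_cases[OF that] assms by auto
  then show ?thesis using Z_inj[of "x - y"] by simp
qed

text \<open>The homomorphism to \<open>\<real>\<close> whose differential is the real part of the coframe element \<open>\<omega>\<^sub>3\<close>.\<close>

definition tau :: "'e \<Rightarrow> real" where
  "tau c = Re (Z 3 c) - Im (cnj (Z 0 c) * Z 1 c)"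

text \<open>On the first three coordinates \<open>A c\<close> is the exponential of \<open>tau c\<close> times the nilpotent matrix with
  entries \<open>1\<close> and \<open>2\<close> below the diagonal; the entry \<open>2\<close> makes the coefficient of \<open>(tau c)\<^sup>2\<close> an integer.\<close>

definition A :: "'e \<Rightarrow> 'e \<Rightarrow> 'e" where
  "A c y = y + e 1 (tau c * Z 0 y) + e 2 (2 * tau c * Z 1 y + (tau c)\<^sup>2 * Z 0 y)
     + e 3 (\<i> * (cnj (Z 1 c) - tau c * cnj (Z 0 c)) * Z 0 y - \<i> * cnj (Z 0 c) * Z 1 y)"

definition B :: "'e \<Rightarrow> 'e \<Rightarrow> 'e" where
  "B c y = y - e 1 (tau c * Z 0 y) + e 2 (- 2 * tau c * Z 1 y + (tau c)\<^sup>2 * Z 0 y)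
     + e 3 (- \<i> * cnj (Z 1 c) * Z 0 y + \<i> * cnj (Z 0 c) * Z 1 y)"

lemma Z_A [simp]:
  "Z 0 (A c y) = Z 0 y"
  "Z 1 (A c y) = Z 1 y + tau c * Z 0 y"
  "Z 2 (A c y) = Z 2 y + 2 * tau c * Z 1 y + (tau c)\<^sup>2 * Z 0 y"
  "Z 3 (A c y) = Z 3 y + \<i> * (cnj (Z 1 c) - tau c * cnj (Z 0 c)) * Z 0 y - \<i> * cnj (Z 0 c) * Z 1 y"
  "4 \<le> k \<Longrightarrow> k < n \<Longrightarrow> Z k (A c y) = Z k y"
  by (simp_all add: A_def)

lemma Z_B [simp]:
  "Z 0 (B c y) = Z 0 y"
  "Z 1 (B c y) = Z 1 y - tau c * Z 0 y"
  "Z 2 (B c y) = Z 2 y - 2 * tau c * Z 1 y + (tau c)\<^sup>2 * Z 0 y"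
  "Z 3 (B c y) = Z 3 y - \<i> * cnj (Z 1 c) * Z 0 y + \<i> * cnj (Z 0 c) * Z 1 y"
  "4 \<le> k \<Longrightarrow> k < n \<Longrightarrow> Z k (B c y) = Z k y"
  by (simp_all add: B_def)

lemma tau_cocycle: "tau (x + A x y) = tau x + tau y"
  by (simp add: tau_def algebra_simps)

lemma smooth_coord:
  "smooth_on UNIV f \<Longrightarrow> smooth_on UNIV (\<lambda>x. Z k (f x))"
  "smooth_on UNIV g \<Longrightarrow> smooth_on UNIV (\<lambda>x. e k (g x))"
  by (rule smooth_linear_compose[OF bl_Z] smooth_linear_compose[OF bl_e]; assumption)+

lemma smooth_A': "smooth_on UNIV f \<Longrightarrow> smooth_on UNIV g \<Longrightarrow> smooth_on UNIV (\<lambda>x. A (f x) (g x))"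
  unfolding A_def tau_def by (intro smooth_intros smooth_coord)

lemma smooth_B': "smooth_on UNIV f \<Longrightarrow> smooth_on UNIV g \<Longrightarrow> smooth_on UNIV (\<lambda>x. B (f x) (g x))"
  unfolding B_def tau_def by (intro smooth_intros smooth_coord)

sublocale affine_group A B
proof
  fix x y z :: 'e and r :: real
  show "A x (y + z) = A x y + A x z"
    by (rule coord_eqI) (simp_all add: algebra_simps)
  show "A x (r *\<^sub>R y) = r *\<^sub>R A x y"
    by (rule coord_eqI) (simp_all add: algebra_simps scaleR_conv_of_real)
  show "A (x + A x y) z = A x (A y z)"
    by (rule coord_eqI) (simp_all add: tau_cocycle algebra_simps power2_eq_square)
  show "B x (A x y) = y"
    by (rule coord_eqI) (simp_all add: algebra_simps power2_eq_square)
  show "A x (B x y) = y"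
    by (rule coord_eqI) (simp_all add: algebra_simps power2_eq_square)
next
  show "smooth_on UNIV (\<lambda>p. A (fst p) (snd p))"
    by (intro smooth_A' smooth_bounded_linear bounded_linear_fst bounded_linear_snd)
  show "smooth_on UNIV (\<lambda>x. B x x)"
    by (intro smooth_B' smooth_bounded_linear bounded_linear_ident)
qed

lemma tau_mul [simp]: "tau (mul x y) = tau x + tau y"
  by (simp add: mul_def tau_cocycle)

lemma Z_mul [simp]:
  "Z 0 (mul x y) = Z 0 x + Z 0 y"
  "Z 1 (mul x y) = Z 1 x + Z 1 y + tau x * Z 0 y"
  "Z 2 (mul x y) = Z 2 x + Z 2 y + 2 * tau x * Z 1 y + (tau x)\<^sup>2 * Z 0 y"
  "Z 3 (mul x y) = Z 3 x + Z 3 y + \<i> * (cnj (Z 1 x) - tau x * cnj (Z 0 x)) * Z 0 y - \<i> * cnj (Z 0 x) * Z 1 y"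
  "4 \<le> k \<Longrightarrow> k < n \<Longrightarrow> Z k (mul x y) = Z k x + Z k y"
  by (simp_all add: mul_def)

subsection \<open>Nilpotency\<close>

lemma tau_iv [simp]: "tau (iv x) = - tau x"
  using tau_mul[of x "iv x"] by (simp add: tau_def del: tau_mul)

lemma Z_iv [simp]:
  "Z 0 (iv x) = - Z 0 x" "Z 1 (iv x) = - Z 1 x + tau x * Z 0 x"
  "4 \<le> k \<Longrightarrow> k < n \<Longrightarrow> Z k (iv x) = - Z k x"
  by (simp_all add: iv_def)

lemma subgroup_grpI:
  assumes "0 \<in> H" "\<And>x y. x \<in> H \<Longrightarrow> y \<in> H \<Longrightarrow> mul x y \<in> H" "\<And>x. x \<in> H \<Longrightarrow> iv x \<in> H"
  shows "subgroup H grp"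
  using assms by (intro group.subgroupI[OF group_grp]) auto

definition commutator :: "'e \<Rightarrow> 'e \<Rightarrow> 'e" where
  "commutator g h = mul (mul (mul g h) (iv g)) (iv h)"

text \<open>Comparing coordinates in this identity determines those of the commutator without computing
  inverses.\<close>

lemma mul_commutator: "mul (commutator g h) (mul h g) = mul g h"
  by (simp add: commutator_def mul_assoc)

lemma lower_central_subset:
  assumes "subgroup H grp" "\<And>g h. g \<in> lower_central grp k \<Longrightarrow> commutator g h \<in> H"
  shows "lower_central grp (Suc k) \<subseteq> H"
proof -
  have "{g \<otimes>\<^bsub>grp\<^esub> h \<otimes>\<^bsub>grp\<^esub> inv\<^bsub>grp\<^esub> g \<otimes>\<^bsub>grp\<^esub> inv\<^bsub>grp\<^esub> h | g h.
      g \<in> lower_central grp k \<and> h \<in> carrier grp} \<subseteq> H"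
    using assms(2) by (auto simp: commutator_def)
  from group.generate_subgroup_incl[OF group_grp this assms(1)] show ?thesis by simp
qed

text \<open>The next two sets contain the terms with index \<open>1\<close> and \<open>2\<close> of the lower central series.\<close>

definition kernel1 :: "'e set" where
  "kernel1 = {x. Z 0 x = 0 \<and> tau x = 0 \<and> (\<forall>k. 4 \<le> k \<and> k < n \<longrightarrow> Z k x = 0)}"

definition kernel2 :: "'e set" where
  "kernel2 = {x \<in> kernel1. Z 1 x = 0}"

lemma commutator_kernel1: "commutator g h \<in> kernel1"
proof -
  have "tau (commutator g h) = 0" "Z 0 (commutator g h) = 0"
    using arg_cong[OF mul_commutator[of g h], of tau] arg_cong[OF mul_commutator[of g h], of "Z 0"]
    by (simp_all add: add.commute)
  moreover have "Z k (commutator g h) = 0" if "4 \<le> k" "k < n" for k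
    using arg_cong[OF mul_commutator[of g h], of "Z k"] that by (simp add: add.commute)
  ultimately show ?thesis by (simp add: kernel1_def)
qed

lemma commutator_kernel2:
  assumes "g \<in> kernel1" shows "commutator g h \<in> kernel2"
  using arg_cong[OF mul_commutator[of g h], of "Z 1"] assms commutator_kernel1[of g h]
  by (auto simp: kernel1_def kernel2_def algebra_simps)

lemma commutator_trivial:
  assumes "g \<in> kernel2" shows "commutator g h = 0"
proof -
  have "mul h g = mul g h"
    using assms by (intro coord_eqI) (auto simp: kernel1_def kernel2_def)
  then show ?thesis
    by (simp add: commutator_def mul_assoc flip: \<open>mul h g = mul g h\<close>)
qed

lemma nilpotent_grp: "nilpotent_group grp"
proof -
  have "subgroup kernel1 grp"
    by (rule subgroup_grpI) (auto simp: kernel1_def tau_def[of 0])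
  then have 1: "lower_central grp 1 \<subseteq> kernel1"
    using lower_central_subset[of kernel1 0] commutator_kernel1 by (simp add: One_nat_def)
  have "subgroup kernel2 grp"
    by (rule subgroup_grpI) (auto simp: kernel1_def kernel2_def tau_def[of 0])
  then have 2: "lower_central grp (Suc 1) \<subseteq> kernel2"
    using lower_central_subset[of kernel2 1] commutator_kernel2 1 by blast
  have "subgroup {0} grp"
    by (rule subgroup_grpI) (auto simp: iv_def linear_0[OF linear_B])
  then have 3: "lower_central grp (Suc (Suc 1)) \<subseteq> {0}"
    using lower_central_subset[of "{0}" "Suc 1"] commutator_trivial 2 by blast
  moreover have "0 \<in> lower_central grp (Suc (Suc 1))"
    using generate.one[of grp] by (simp only: lower_central.simps grp_simps)
  ultimately show ?thesis unfolding nilpotent_group_def by (metis grp_simps(3) empty_iff subset_singletonD)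
qed

subsection \<open>The lattice of Gaussian integer points\<close>

definition \<Gamma> :: "'e set" where "\<Gamma> = {x. \<forall>k<n. Z k x \<in> gauss_ints}"

text \<open>The bound \<open>6\<close> is needed for the coordinate with index \<open>3\<close>: its real part is only controlled through
  \<open>tau\<close>, by \<open>1 + 2 * 2\<close>, and its imaginary part by \<open>1\<close>.\<close>

definition K :: "'e set" where "K = {x. \<forall>k<n. cmod (Z k x) \<le> 6}"

lemma \<Gamma>_D: "x \<in> \<Gamma> \<Longrightarrow> Z 0 x \<in> gauss_ints \<and> Z 1 x \<in> gauss_ints \<and> Z 2 x \<in> gauss_ints \<and> Z 3 x \<in> gauss_ints"
  using n by (simp add: \<Gamma>_def)

text \<open>Since \<open>A x\<close> depends on \<open>x\<close> only through \<open>tau x\<close> and coordinates of \<open>x\<close>, this is the reason why \<open>\<Gamma>\<close>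
  is closed under multiplication.\<close>

lemma tau_\<Gamma>: "x \<in> \<Gamma> \<Longrightarrow> tau x \<in> \<int>"
  using \<Gamma>_D[of x] by (auto simp: tau_def gauss_ints_def)

lemma \<Gamma>_I:
  assumes "Z 0 x \<in> gauss_ints" "Z 1 x \<in> gauss_ints" "Z 2 x \<in> gauss_ints" "Z 3 x \<in> gauss_ints"
    "\<And>k. 4 \<le> k \<Longrightarrow> k < n \<Longrightarrow> Z k x \<in> gauss_ints"
  shows "x \<in> \<Gamma>"
  unfolding \<Gamma>_def using assms less_n_cases by blast

lemma subgroup_\<Gamma>_grp: "subgroup \<Gamma> grp"
proof (rule subgroup_grpI)
  show "0 \<in> \<Gamma>" by (rule \<Gamma>_I) simp_all
next
  fix x assume x: "x \<in> \<Gamma>"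
  note xs = \<Gamma>_D[OF x] tau_\<Gamma>[OF x]
  have "Z k x \<in> gauss_ints" if "k < n" for k using x that by (simp add: \<Gamma>_def)
  then show "iv x \<in> \<Gamma>" unfolding iv_def
    by (intro \<Gamma>_I) (simp_all add: xs gauss_ints_intros)
  fix y assume y: "y \<in> \<Gamma>"
  note ys = \<Gamma>_D[OF y]
  show "mul x y \<in> \<Gamma>"
    using x y by (intro \<Gamma>_I) (simp_all add: xs ys gauss_ints_intros \<Gamma>_def[THEN eqset_imp_iff])
qed

lemma continuous_Z: "continuous_on S (Z k)"
  using linear_continuous_on[OF bl_Z] .

lemma closed_\<Gamma>_set: "closed \<Gamma>"
proof -
  have "\<Gamma> = (\<Inter>k<n. Z k -` gauss_ints)" by (auto simp: \<Gamma>_def)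
  then show ?thesis
    by (auto intro!: closed_INT closed_vimage closed_gauss_ints continuous_Z)
qed

lemma gauss_ints_small: "w \<in> gauss_ints \<Longrightarrow> cmod w < 1 \<Longrightarrow> w = 0"
  using abs_Re_le_cmod[of w] abs_Im_le_cmod[of w]
  by (auto simp: gauss_ints_def complex_eq_iff intro!: Ints_nonzero_abs_less1)

lemma discrete_\<Gamma>_set: "\<exists>U. open U \<and> 0 \<in> U \<and> \<Gamma> \<inter> U = {0}"
proof (intro exI[of _ "\<Inter>k<n. Z k -` ball 0 1"] conjI)
  show "open (\<Inter>k<n. Z k -` ball 0 1)"
    by (auto intro!: open_INT open_vimage continuous_Z)
  have "x = 0" if "x \<in> \<Gamma>" "\<forall>k<n. cmod (Z k x) < 1" for x
    using that gauss_ints_small by (intro Z_inj) (auto simp: \<Gamma>_def)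
  then show "\<Gamma> \<inter> (\<Inter>k<n. Z k -` ball 0 1) = {0}"
    by (auto simp: \<Gamma>_def)
qed auto

lemma coord_expansion: "x = (\<Sum>k<n. e k (Z k x))"
proof -
  have "Z j (x - (\<Sum>k<n. e k (Z k x))) = 0" if "j < n" for j
  proof -
    have "Z j (\<Sum>k<n. e k (Z k x)) = (\<Sum>k<n. Z j (e k (Z k x)))"
      using linear_sum[OF bounded_linear.linear[OF bl_Z]] by simp
    also have "\<dots> = (\<Sum>k<n. if k = j then Z k x else 0)"
      using that by (intro sum.cong) (auto simp: Z_e)
    also have "\<dots> = Z j x" using that by simp
    finally show ?thesis by simp
  qed
  then show ?thesis using Z_inj[of "x - (\<Sum>k<n. e k (Z k x))"] by simp
qed

lemma compact_K_set: "compact K"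
proof -
  have "K = (\<Inter>k<n. Z k -` cball 0 6)" by (auto simp: K_def)
  then have "closed K" by (auto intro!: closed_INT closed_vimage continuous_Z)
  moreover have "norm x \<le> (\<Sum>k<n. onorm (e k) * 6)" if "x \<in> K" for x
  proof -
    have "norm (e k (Z k x)) \<le> onorm (e k) * 6" if "k < n" for k
    proof -
      have "norm (e k (Z k x)) \<le> onorm (e k) * norm (Z k x)" by (rule onorm[OF bl_e])
      also have "\<dots> \<le> onorm (e k) * 6"
        using \<open>x \<in> K\<close> that onorm_pos_le[OF bl_e] by (intro mult_left_mono) (auto simp: K_def)
      finally show ?thesis .
    qed
    then have "norm (\<Sum>k<n. e k (Z k x)) \<le> (\<Sum>k<n. onorm (e k) * 6)"
      by (intro sum_norm_le) auto
    then show ?thesis using coord_expansion[of x] by simp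
  qed
  ultimately show ?thesis by (auto simp: compact_eq_bounded_closed bounded_iff)
qed

lemma Z_rest:
  assumes "k < n" shows "Z k (\<Sum>j=4..<n. e j (f j)) = (if 4 \<le> k then f k else 0)"
proof -
  have "Z k (\<Sum>j=4..<n. e j (f j)) = (\<Sum>j=4..<n. Z k (e j (f j)))"
    using linear_sum[OF bounded_linear.linear[OF bl_Z]] by simp
  also have "\<dots> = (\<Sum>j=4..<n. if j = k then f k else 0)"
    using assms by (intro sum.cong) (auto simp: Z_e)
  also have "\<dots> = (if 4 \<le> k then f k else 0)" using assms by auto
  finally show ?thesis .
qed

text \<open>The coordinates are reduced one after the other, \<open>tau\<close> taking the place of the real part of the
  coordinate with index \<open>3\<close>. From the second step on, the translating elements have \<open>tau = 0\<close> and
  act trivially on the coordinates that have been treated already.\<close>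

lemma cover_K_set: "\<exists>\<gamma>\<in>\<Gamma>. mul \<gamma> x \<in> K"
proof -
  define m1 where "m1 = - real_of_int \<lfloor>tau x\<rfloor>"
  define g1 where "g1 = e 0 (round_off (Z 0 x)) + e 3 (complex_of_real m1)
    + (\<Sum>j=4..<n. e j (round_off (Z j x)))"
  have Z_g1: "Z 0 g1 = round_off (Z 0 x)" "Z 1 g1 = 0" "Z 2 g1 = 0" "Z 3 g1 = complex_of_real m1"
    "\<And>k. 4 \<le> k \<Longrightarrow> k < n \<Longrightarrow> Z k g1 = round_off (Z k x)"
    using n by (simp_all add: g1_def Z_rest)
  have "complex_of_real m1 \<in> gauss_ints" by (simp add: gauss_ints_def m1_def)
  then have g1: "g1 \<in> \<Gamma>" by (intro \<Gamma>_I) (simp_all add: Z_g1 round_off(1))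
  define x1 where "x1 = mul g1 x"
  have x1: "cmod (Z 0 x1) \<le> 2" "\<bar>tau x1\<bar> \<le> 1" "\<And>k. 4 \<le> k \<Longrightarrow> k < n \<Longrightarrow> cmod (Z k x1) \<le> 2"
  proof -
    show "cmod (Z 0 x1) \<le> 2" using round_off(2)[of "Z 0 x"] by (simp add: x1_def Z_g1 add.commute)
    have "tau g1 = m1" by (simp add: tau_def Z_g1)
    then show "\<bar>tau x1\<bar> \<le> 1" by (simp add: x1_def m1_def) linarith
    fix k assume "4 \<le> k" "k < n"
    then show "cmod (Z k x1) \<le> 2" using round_off(2)[of "Z k x"] by (simp add: x1_def Z_g1 add.commute)
  qed
  define g2 where "g2 = e 1 (round_off (Z 1 x1))"
  have g2: "g2 \<in> \<Gamma>" by (rule \<Gamma>_I) (simp_all add: g2_def round_off(1))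
  have tau2: "tau g2 = 0" by (simp add: tau_def g2_def)
  define x2 where "x2 = mul g2 x1"
  have x2: "Z 0 x2 = Z 0 x1" "tau x2 = tau x1" "\<And>k. 4 \<le> k \<Longrightarrow> k < n \<Longrightarrow> Z k x2 = Z k x1"
    by (simp_all add: x2_def tau2) (simp_all add: g2_def)
  have x2': "cmod (Z 1 x2) \<le> 2"
    using round_off(2)[of "Z 1 x1"] by (simp add: x2_def tau2) (simp add: g2_def add.commute)
  define g3 where "g3 = e 2 (round_off (Z 2 x2))"
  have g3: "g3 \<in> \<Gamma>" by (rule \<Gamma>_I) (simp_all add: g3_def round_off(1))
  have tau3: "tau g3 = 0" by (simp add: tau_def g3_def)
  define x3 where "x3 = mul g3 x2"
  have x3: "Z 0 x3 = Z 0 x2" "Z 1 x3 = Z 1 x2" "tau x3 = tau x2"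
    "\<And>k. 4 \<le> k \<Longrightarrow> k < n \<Longrightarrow> Z k x3 = Z k x2"
    by (simp_all add: x3_def tau3) (simp_all add: g3_def)
  have x3': "cmod (Z 2 x3) \<le> 2"
    using round_off(2)[of "Z 2 x2"] by (simp add: x3_def tau3) (simp add: g3_def add.commute)
  define m4 where "m4 = - real_of_int \<lfloor>Im (Z 3 x3)\<rfloor>"
  define g4 where "g4 = e 3 (\<i> * complex_of_real m4)"
  have "\<i> * complex_of_real m4 \<in> gauss_ints" by (simp add: gauss_ints_def m4_def)
  then have g4: "g4 \<in> \<Gamma>" by (intro \<Gamma>_I) (simp_all add: g4_def)
  have tau4: "tau g4 = 0" by (simp add: tau_def g4_def)
  define x4 where "x4 = mul g4 x3"
  have x4: "Z 0 x4 = Z 0 x3" "Z 1 x4 = Z 1 x3" "Z 2 x4 = Z 2 x3" "tau x4 = tau x3"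
    "\<And>k. 4 \<le> k \<Longrightarrow> k < n \<Longrightarrow> Z k x4 = Z k x3"
    by (simp_all add: x4_def tau4) (simp_all add: g4_def)
  have "\<bar>Im (Z 3 x4)\<bar> \<le> 1"
    by (simp add: x4_def tau4) (simp add: g4_def m4_def, linarith)
  moreover have "\<bar>Re (Z 3 x4)\<bar> \<le> 5"
  proof -
    have "\<bar>Im (cnj (Z 0 x4) * Z 1 x4)\<bar> \<le> cmod (Z 0 x4) * cmod (Z 1 x4)"
      using abs_Im_le_cmod[of "cnj (Z 0 x4) * Z 1 x4"] by (simp add: norm_mult)
    also have "\<dots> \<le> 2 * 2"
      using x1(1) x2' by (intro mult_mono) (simp_all add: x4 x3 x2)
    finally have "\<bar>Im (cnj (Z 0 x4) * Z 1 x4)\<bar> \<le> 4" by simp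
    moreover have "\<bar>tau x4\<bar> \<le> 1" using x1(2) by (simp add: x4 x3 x2)
    ultimately show ?thesis unfolding tau_def by linarith
  qed
  ultimately have "cmod (Z 3 x4) \<le> 6"
    using cmod_le[of "Z 3 x4"] by linarith
  moreover have "cmod (Z 0 x4) \<le> 6" "cmod (Z 1 x4) \<le> 6" "cmod (Z 2 x4) \<le> 6"
    "\<And>k. 4 \<le> k \<Longrightarrow> k < n \<Longrightarrow> cmod (Z k x4) \<le> 6"
    using x1(1,3) x2' x3' by (force simp: x4 x3 x2)+
  ultimately have "x4 \<in> K"
    unfolding K_def using less_n_cases by blast
  moreover have "x4 = mul (mul g4 (mul g3 (mul g2 g1))) x"
    by (simp add: x4_def x3_def x2_def x1_def mul_assoc)
  moreover have "mul g4 (mul g3 (mul g2 g1)) \<in> \<Gamma>"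
    using g1 g2 g3 g4 subgroup.m_closed[OF subgroup_\<Gamma>_grp] by simp
  ultimately show ?thesis by metis
qed

sublocale affine_lattice A B \<Gamma> K
  by (intro affine_lattice.intro affine_lattice_axioms.intro affine_group_axioms)
    (fact subgroup_\<Gamma>_grp closed_\<Gamma>_set discrete_\<Gamma>_set compact_K_set cover_K_set)+

subsection \<open>The complex structure\<close>

definition J :: "'e \<Rightarrow> 'e" where "J x = (\<Sum>k<n. e k (\<i> * Z k x))"

lemma Z_J: assumes "j < n" shows "Z j (J x) = \<i> * Z j x"
proof -
  have "Z j (J x) = (\<Sum>k<n. Z j (e k (\<i> * Z k x)))"
    unfolding J_def using linear_sum[OF bounded_linear.linear[OF bl_Z]] by simp
  also have "\<dots> = (\<Sum>k<n. if k = j then \<i> * Z k x else 0)"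
    using assms by (intro sum.cong) (auto simp: Z_e)
  also have "\<dots> = \<i> * Z j x" using assms by simp
  finally show ?thesis .
qed

lemma Z_J_simps [simp]:
  "Z 0 (J x) = \<i> * Z 0 x" "Z 1 (J x) = \<i> * Z 1 x" "Z 2 (J x) = \<i> * Z 2 x" "Z 3 (J x) = \<i> * Z 3 x"
  "4 \<le> k \<Longrightarrow> k < n \<Longrightarrow> Z k (J x) = \<i> * Z k x"
  using n by (simp_all add: Z_J)

lemma linear_J: "linear J"
proof
  show "J (x + y) = J x + J y" for x y by (rule coord_eqI) (simp_all add: algebra_simps)
  show "J (r *\<^sub>R x) = r *\<^sub>R J x" for r x by (rule coord_eqI) simp_all
qed

lemma J_J: "J (J x) = - x"
  by (rule coord_eqI) simp_all

lemma A_J: "A x (J v) = J (A x v)"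
  by (rule coord_eqI) (simp_all add: algebra_simps)

subsection \<open>Brackets\<close>

lemma has_derivative_coord [derivative_intros]:
  "(f has_derivative f') F \<Longrightarrow> ((\<lambda>x. Z k (f x)) has_derivative (\<lambda>x. Z k (f' x))) F"
  "(g has_derivative g') F \<Longrightarrow> ((\<lambda>x. e k (g x)) has_derivative (\<lambda>x. e k (g' x))) F"
  by (rule bounded_linear.has_derivative[OF bl_Z] bounded_linear.has_derivative[OF bl_e]; assumption)+

lemma e_linear [simp]: "e k (a + b) = e k a + e k b" "e k (a - b) = e k a - e k b" "e k (- a) = - e k a" "e k 0 = 0"
  using bounded_linear.linear[OF bl_e[of k]]
  by (simp_all add: linear_add linear_diff linear_neg linear_0)

text \<open>The first argument is the base point, the second the direction.\<close>

definition dtau :: "'e \<Rightarrow> 'e \<Rightarrow> real" where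
  "dtau x u = Re (Z 3 u) - Im (cnj (Z 0 u) * Z 1 x + cnj (Z 0 x) * Z 1 u)"

lemma tau_has_derivative: "(tau has_derivative dtau x) (at x)"
  unfolding tau_def dtau_def[abs_def]
  by (auto intro!: derivative_eq_intros has_derivative_Re has_derivative_Im simp: fun_eq_iff)

lemma tau_has_derivative' [derivative_intros]:
  "((\<lambda>x. complex_of_real (tau x)) has_derivative (\<lambda>u. complex_of_real (dtau x u))) (at x)"
  by (rule bounded_linear.has_derivative[OF bounded_linear_of_real tau_has_derivative])

lemma brk_eq:
  "brk u v = e 1 (Re (Z 3 u) * Z 0 v - Re (Z 3 v) * Z 0 u)
    + e 2 (2 * (Re (Z 3 u) * Z 1 v - Re (Z 3 v) * Z 1 u))
    + e 3 (\<i> * (cnj (Z 1 u) * Z 0 v - cnj (Z 0 u) * Z 1 v - cnj (Z 1 v) * Z 0 u + cnj (Z 0 v) * Z 1 u))"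
proof -
  have D: "((\<lambda>x. A x v) has_derivative (\<lambda>u. e 1 (Re (Z 3 u) * Z 0 v) + e 2 (2 * Re (Z 3 u) * Z 1 v)
      + e 3 (\<i> * cnj (Z 1 u) * Z 0 v - \<i> * cnj (Z 0 u) * Z 1 v))) (at 0)" for v
    unfolding A_def
    by (auto intro!: derivative_eq_intros simp: fun_eq_iff dtau_def tau_def[of 0] algebra_simps)
  have "frechet_derivative (\<lambda>x. A x v) (at 0) = (\<lambda>u. e 1 (Re (Z 3 u) * Z 0 v) + e 2 (2 * Re (Z 3 u) * Z 1 v)
      + e 3 (\<i> * cnj (Z 1 u) * Z 0 v - \<i> * cnj (Z 0 u) * Z 1 v))" for v
    using frechet_derivative_at[OF D] by metis
  then show ?thesis
    by (intro coord_eqI) (simp_all add: brk_def algebra_simps)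
qed

lemma Z_brk:
  "Z 1 (brk u v) = Re (Z 3 u) * Z 0 v - Re (Z 3 v) * Z 0 u"
  "Z 3 (brk u v) = \<i> * (cnj (Z 1 u) * Z 0 v - cnj (Z 0 u) * Z 1 v - cnj (Z 1 v) * Z 0 u + cnj (Z 0 v) * Z 1 u)"
  by (simp_all add: brk_eq)

text \<open>The barrier consists of the directions of \<open>\<omega>\<^sub>2\<close> and of the abelian factor.
  Three test vectors suffice: \<open>Re (Z 3 u)\<close> and \<open>Z 0 u\<close> are read off from the coordinate \<open>1\<close> of the
  bracket, \<open>Im (Z 3 u)\<close> from that of the rotated vector, and \<open>Z 1 u\<close> then from the coordinate \<open>3\<close>.\<close>

lemma non_nilpotent_J: "non_nilpotent_structure grp affine_mfd (\<lambda>c x. J)"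
proof (rule non_nilpotent_structure[where W = "{x. Z 0 x = 0 \<and> Z 1 x = 0 \<and> Z 3 x = 0}"])
  have "e 0 1 \<notin> {x. Z 0 x = 0 \<and> Z 1 x = 0 \<and> Z 3 x = 0}" by simp
  then show "{x. Z 0 x = 0 \<and> Z 1 x = 0 \<and> Z 3 x = 0} \<noteq> UNIV" by blast
next
  fix u
  assume "\<And>v. brk u v \<in> {x. Z 0 x = 0 \<and> Z 1 x = 0 \<and> Z 3 x = 0}"
    and "\<And>v. brk (J u) v \<in> {x. Z 0 x = 0 \<and> Z 1 x = 0 \<and> Z 3 x = 0}"
  then have b: "Z 1 (brk u v) = 0" "Z 3 (brk u v) = 0" "Z 1 (brk (J u) v) = 0" for v by auto
  have "Re (Z 3 u) = 0" using b(1)[of "e 0 1"] by (simp add: Z_brk)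
  moreover have "Im (Z 3 u) = 0" using b(3)[of "e 0 1"] by (simp add: Z_brk)
  moreover have u0: "Z 0 u = 0" using b(1)[of "e 3 1"] by (simp add: Z_brk)
  moreover have "Re (Z 1 u) = 0" using b(2)[of "e 0 1"] by (simp add: Z_brk u0 complex_eq_iff)
  moreover have "Im (Z 1 u) = 0" using b(2)[of "e 0 \<i>"] by (simp add: Z_brk u0 complex_eq_iff)
  ultimately show "u \<in> {x. Z 0 x = 0 \<and> Z 1 x = 0 \<and> Z 3 x = 0}" by (simp add: complex_eq_iff)
qed (simp_all add: A_J)

subsection \<open>The pseudo-Kaehler form\<close>

text \<open>In terms of the coframe this is the real part of \<open>(1 + \<i>) \<omega>\<^sub>0 \<and> cnj \<omega>\<^sub>2\<close> minus
  \<open>\<i> \<omega>\<^sub>1 \<and> cnj \<omega>\<^sub>1\<close> and minus \<open>(\<i>/2) \<omega>\<^sub>k \<and> cnj \<omega>\<^sub>k\<close> for \<open>k \<ge> 3\<close>.\<close>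

definition F0 :: "'e \<Rightarrow> 'e \<Rightarrow> real" where
  "F0 u v = Re ((1 + \<i>) * (Z 0 u * cnj (Z 2 v) - Z 0 v * cnj (Z 2 u)))
    + 2 * Im (Z 1 u * cnj (Z 1 v)) + Im (Z 3 u * cnj (Z 3 v))
    + (\<Sum>k=4..<n. Im (Z k u * cnj (Z k v)))"

lemma F0_skew: "F0 u v = - F0 v u"
  by (simp add: F0_def sum_subtractf algebra_simps)

lemma bilinear_F0: "bilinear F0"
proof -
  have l: "linear (\<lambda>v. F0 u v)" for u
    by (rule linearI) (simp_all add: F0_def algebra_simps sum.distrib sum_subtractf sum_distrib_left)
  have "linear (\<lambda>u. - F0 v u)" for v using linear_compose_neg[OF l] .
  then have "linear (\<lambda>u. F0 u v)" for v using F0_skew[of _ v] by simp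
  with l show ?thesis by (simp add: bilinear_def)
qed

lemma F0_J: "F0 (J u) (J v) = F0 u v"
proof -
  have "(\<Sum>k=4..<n. Im (Z k (J u) * cnj (Z k (J v)))) = (\<Sum>k=4..<n. Im (Z k u * cnj (Z k v)))"
    by (intro sum.cong) (simp_all add: algebra_simps)
  then show ?thesis by (simp add: F0_def algebra_simps)
qed

lemma F0_nondegenerate:
  assumes "\<And>v. F0 u v = 0" shows "u = 0"
proof -
  have rest: "(\<Sum>k=4..<n. Im (Z k u * cnj (Z k (e j w)))) = (if 4 \<le> j then Im (Z j u * cnj w) else 0)"
    if "j < n" for j w
  proof -
    have "(\<Sum>k=4..<n. Im (Z k u * cnj (Z k (e j w)))) = (\<Sum>k=4..<n. if k = j then Im (Z j u * cnj w) else 0)"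
      using that by (intro sum.cong) (auto simp: Z_e)
    then show ?thesis using that by simp
  qed
  note F = F0_def rest
  have F_rest: "F0 u (e k w) = Im (Z k u * cnj w)" if "4 \<le> k" "k < n" for k w
    unfolding F0_def rest[OF that(2)] using that by (simp add: Z_e)
  have "Z 0 u = 0"
    using assms[of "e 2 1"] assms[of "e 2 \<i>"] n by (simp add: F complex_eq_iff)
  moreover have "Z 2 u = 0"
    using assms[of "e 0 1"] assms[of "e 0 \<i>"] n by (simp add: F complex_eq_iff)
  moreover have "Z 1 u = 0"
    using assms[of "e 1 1"] assms[of "e 1 \<i>"] n by (simp add: F complex_eq_iff)
  moreover have "Z 3 u = 0"
    using assms[of "e 3 1"] assms[of "e 3 \<i>"] n by (simp add: F complex_eq_iff)
  moreover have "Z k u = 0" if "4 \<le> k" "k < n" for k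
    using assms[of "e k 1"] assms[of "e k \<i>"] that by (simp add: F_rest complex_eq_iff)
  ultimately show ?thesis by (intro coord_eqI) simp_all
qed

lemma smooth_F: "smooth_on UNIV (\<lambda>x. F0 (B x u) (B x v))"
  unfolding F0_def
  by (intro smooth_intros smooth_coord smooth_sum smooth_B' smooth_bounded_linear bounded_linear_ident) simp_all

text \<open>The derivative at \<open>x\<close> in direction \<open>u\<close> of the frame coordinates \<open>B y v\<close> of a fixed vector \<open>v\<close>.\<close>

definition dB :: "'e \<Rightarrow> 'e \<Rightarrow> 'e \<Rightarrow> 'e" where
  "dB x u v = - e 1 (dtau x u * Z 0 v)
    + e 2 (- 2 * dtau x u * Z 1 v + 2 * tau x * dtau x u * Z 0 v)
    + e 3 (- \<i> * cnj (Z 1 u) * Z 0 v + \<i> * cnj (Z 0 u) * Z 1 v)"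

lemma B_has_derivative: "((\<lambda>y. B y v) has_derivative (\<lambda>u. dB x u v)) (at x)"
  unfolding B_def dB_def
  by (auto intro!: derivative_eq_intros simp: fun_eq_iff algebra_simps)

lemma F_has_derivative:
  "frechet_derivative (\<lambda>y. F0 (B y v) (B y w)) (at x) u = F0 (B x v) (dB x u w) + F0 (dB x u v) (B x w)"
proof -
  have "bounded_bilinear F0" using bilinear_F0 bilinear_conv_bounded_bilinear by blast
  from bounded_bilinear.FDERIV[OF this B_has_derivative B_has_derivative]
  have "((\<lambda>y. F0 (B y v) (B y w)) has_derivative
     (\<lambda>u. F0 (B x v) (dB x u w) + F0 (dB x u v) (B x w))) (at x)" .
  from frechet_derivative_at[OF this] show ?thesis by metis
qed

text \<open>The differential of the coframe, as a bilinear map in frame coordinates; up to sign it is the Lie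
  bracket.\<close>

definition torsion :: "'e \<Rightarrow> 'e \<Rightarrow> 'e" where
  "torsion u v = e 1 (Z 0 u * Re (Z 3 v) - Z 0 v * Re (Z 3 u))
    + e 2 (2 * (Z 1 u * Re (Z 3 v) - Z 1 v * Re (Z 3 u)))
    + e 3 (\<i> * (Z 0 u * cnj (Z 1 v) - Z 0 v * cnj (Z 1 u) - Z 1 u * cnj (Z 0 v) + Z 1 v * cnj (Z 0 u)))"

lemma Z_torsion:
  "Z 0 (torsion u v) = 0"
  "Z 1 (torsion u v) = Z 0 u * Re (Z 3 v) - Z 0 v * Re (Z 3 u)"
  "Z 2 (torsion u v) = 2 * (Z 1 u * Re (Z 3 v) - Z 1 v * Re (Z 3 u))"
  "Z 3 (torsion u v) = \<i> * (Z 0 u * cnj (Z 1 v) - Z 0 v * cnj (Z 1 u) - Z 1 u * cnj (Z 0 v) + Z 1 v * cnj (Z 0 u))"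
  "4 \<le> k \<Longrightarrow> k < n \<Longrightarrow> Z k (torsion u v) = 0"
  by (simp_all add: torsion_def)

lemma dtau_B: "dtau x u = Re (Z 3 (B x u))"
  by (simp add: dtau_def algebra_simps)

lemma dB_torsion: "dB x u v - dB x v u = torsion (B x u) (B x v)"
proof (rule coord_eqI)
  show "Z 1 (dB x u v - dB x v u) = Z 1 (torsion (B x u) (B x v))"
    by (simp add: dB_def Z_torsion dtau_B[symmetric] del: Z_B(4))
  show "Z 2 (dB x u v - dB x v u) = Z 2 (torsion (B x u) (B x v))"
    by (simp add: dB_def Z_torsion dtau_B[symmetric] del: Z_B(4))
       (simp add: algebra_simps)
  show "Z 3 (dB x u v - dB x v u) = Z 3 (torsion (B x u) (B x v))"
    by (simp add: dB_def Z_torsion algebra_simps)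
qed (simp_all add: dB_def Z_torsion)

text \<open>This is closedness at the level of the Lie algebra.\<close>

lemma F0_torsion_cyclic: "F0 (torsion u v) w + F0 (torsion v w) u + F0 (torsion w u) v = 0"
proof -
  have "(\<Sum>k=4..<n. Im (Z k (torsion u v) * cnj (Z k w))) = 0" for u v w
    by (rule sum.neutral) (simp add: Z_torsion)
  then show ?thesis
    by (simp add: F0_def Z_torsion algebra_simps)
qed

text \<open>Differentiating both frame-coordinate arguments of \<open>F0\<close> and pairing the six terms by skew-symmetry
  leaves the cyclic sum over the differential of the coframe.\<close>

lemma closed_F:
  "frechet_derivative (\<lambda>y. F0 (B y v) (B y w)) (at x) u
    - frechet_derivative (\<lambda>y. F0 (B y u) (B y w)) (at x) v
    + frechet_derivative (\<lambda>y. F0 (B y u) (B y v)) (at x) w = 0"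
proof -
  have lin: "F0 (a - b) c = F0 a c - F0 b c" for a b c
    using bilinear_F0 by (rule bilinear_lsub)
  have "F0 (torsion (B x u) (B x v)) (B x w) + F0 (torsion (B x v) (B x w)) (B x u)
      + F0 (torsion (B x w) (B x u)) (B x v) = 0"
    by (rule F0_torsion_cyclic)
  then show ?thesis
    using F0_skew[of "B x v" "dB x u w"] F0_skew[of "B x u" "dB x v w"] F0_skew[of "B x u" "dB x w v"]
    by (simp add: F_has_derivative lin flip: dB_torsion)
qed

theorem pseudo_kaehler_example:
  "nilmanifold grp affine_mfd \<Gamma> \<and>
   left_invariant_complex_structure grp affine_mfd (\<lambda>c x. J) \<and>
   non_nilpotent_structure grp affine_mfd (\<lambda>c x. J) \<and>
   induced_complex_structure grp affine_mfd \<Gamma> (\<lambda>c x. J) (\<lambda>c x. J) \<and>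
   pseudo_kaehler_metric quot (\<lambda>c x. J) (\<lambda>c x u v. F0 (B x u) (B x v))"
  using nilmanifold[OF nilpotent_grp] left_invariant_complex_structure[OF linear_J J_J A_J]
    non_nilpotent_J induced_complex_structure[OF linear_J J_J A_J]
    pseudo_kaehler_metric[OF bilinear_F0 F0_skew F0_nondegenerate A_J F0_J smooth_F closed_F]
  by simp

end

text \<open>The index type is enumerated, and consecutive indices are paired into real and imaginary parts.\<close>

lemma complex_coordinates_exist:
  assumes "4 \<le> n" "CARD('m::finite) = 2 * n"
  shows "\<exists>(Z :: nat \<Rightarrow> real ^ 'm \<Rightarrow> complex) e. complex_coordinates Z e n"
proof -
  obtain f :: "nat \<Rightarrow> 'm" where f: "bij_betw f {..<2 * n} UNIV"
    using ex_bij_betw_nat_finite[of "UNIV :: 'm set"] assms(2) by (auto simp: atLeast0LessThan)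
  have inj: "f i = f j \<longleftrightarrow> i = j" if "i < 2 * n" "j < 2 * n" for i j
    using f that by (auto simp: bij_betw_def inj_on_def)
  define Z :: "nat \<Rightarrow> real ^ 'm \<Rightarrow> complex" where
    "Z k x = Complex (x $ f (2 * k)) (x $ f (2 * k + 1))" for k x
  define e :: "nat \<Rightarrow> complex \<Rightarrow> real ^ 'm" where
    "e k w = axis (f (2 * k)) (Re w) + axis (f (2 * k + 1)) (Im w)" for k w
  have "complex_coordinates Z e n"
  proof (rule complex_coordinates.intro)
    show "4 \<le> n" by fact
    show "bounded_linear (Z k)" for k
      unfolding linear_conv_bounded_linear[symmetric]
      by (rule linearI) (simp_all add: Z_def complex_eq_iff)
    show "bounded_linear (e k)" for k
      unfolding linear_conv_bounded_linear[symmetric]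
      by (rule linearI) (simp_all add: e_def vec_eq_iff axis_def distrib_left)
    fix j k w assume "j < n" "k < n"
    then have "2 * j < 2 * n" "2 * j + 1 < 2 * n" "2 * k < 2 * n" "2 * k + 1 < 2 * n" by auto
    moreover have "2 * j \<noteq> 2 * k + 1" "2 * k \<noteq> 2 * j + 1" by presburger+
    ultimately show "Z j (e k w) = (if j = k then w else 0)"
      by (simp add: Z_def e_def axis_def inj complex_eq_iff)
  next
    fix x assume Z0: "\<And>k. k < n \<Longrightarrow> Z k x = 0"
    have "x $ i = 0" for i
    proof -
      obtain m where m: "m < 2 * n" "i = f m"
        using f by (auto simp: bij_betw_def image_iff)
      then have "m div 2 < n" by simp
      from Z0[OF this] have "x $ f (2 * (m div 2)) = 0" "x $ f (2 * (m div 2) + 1) = 0"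
        by (simp_all add: Z_def complex_eq_iff)
      moreover have "m = 2 * (m div 2) \<or> m = 2 * (m div 2) + 1" by presburger
      ultimately show ?thesis using m(2) by metis
    qed
    then show "x = 0" by (simp add: vec_eq_iff)
  qed
  then show ?thesis by blast
qed

theorem proposition3p6:
  fixes n :: nat
  assumes "n \<ge> 4" and "CARD('m::finite) = 2 * n"
  shows "\<exists>(G :: (real ^ 'm) monoid) (M :: (real ^ 'm, real ^ 'm) mfd) \<Gamma> J J' F.
           nilmanifold G M \<Gamma> \<and>
           left_invariant_complex_structure G M J \<and>
           non_nilpotent_structure G M J \<and>
           induced_complex_structure G M \<Gamma> J J' \<and>
           pseudo_kaehler_metric (quotient_mfd G M \<Gamma>) J' F"
proof -
  obtain Z :: "nat \<Rightarrow> real ^ 'm \<Rightarrow> complex" and e where "complex_coordinates Z e n"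
    using complex_coordinates_exist assms by blast
  then interpret complex_coordinates Z e n .
  show ?thesis using pseudo_kaehler_example by blast
qed

end
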